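(* There exists a 2-functor $\mathrm{imp}\colon \mathrm{W2G}\to\mathrm{C2G}$ which sends any object $C\in\mathrm{W2G}$ to a coherent 2-group $\mathrm{imp}(C)\in\mathrm{C2G}$ obtained from $C$ by equipping each object of $C$ with an adjoint equivalence, and which acts as the identity on morphisms and 2-morphisms.
   Context: A weak monoidal category is a category $M$ with a functor $\otimes\colon M\times M\to M$, an object $1\in M$, and natural isomorphisms $a_{x,y,z}\colon (x\otimes y)\otimes z\to x\otimes(y\otimes z)$, $\ell_x\colon 1\otimes x\to x$, $r_x\colon x\otimes 1\to x$ satisfying Mac Lane's pentagon and triangle identities (i.e. a monoidal category in the usual, not necessarily strict, sense). A weak inverse of an object $x$ is an object $y$ such that $x\otimes y\cong 1$ and $y\otimes x\cong 1$; if one exists, $x$ is weakly invertible. A weak 2-group is a weak monoidal category in which all objects are weakly invertible and all morphisms are invertible. An adjunction in a weak monoidal category is a quadruple $(x,\bar{x},i_x,e_x)$ where $i_x\colon 1\to x\otimes\bar{x}$ and $e_x\colon \bar{x}\otimes x\to 1$ are morphisms satisfying the zig-zag identities: (1) the composite $1\otimes x \xrightarrow{i_x\otimes 1} (x\otimes\bar{x})\otimes x \xrightarrow{a_{x,\bar{x},x}} x\otimes(\bar{x}\otimes x)\xrightarrow{1\otimes e_x} x\otimes 1$ equals $1\otimes x\xrightarrow{\ell_x} x\xrightarrow{r_x^{-1}} x\otimes 1$; (2) the composite $\bar{x}\otimes 1\xrightarrow{1\otimes i_x}\bar{x}\otimes(x\otimes\bar{x})\xrightarrow{a^{-1}_{\bar{x},x,\bar{x}}}(\bar{x}\otimes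 x)\otimes\bar{x}\xrightarrow{e_x\otimes 1}1\otimes\bar{x}$ equals $\bar{x}\otimes 1\xrightarrow{r_{\bar{x}}}\bar{x}\xrightarrow{\ell_{\bar{x}}^{-1}}1\otimes\bar{x}$. An adjoint equivalence is an adjunction with $i_x$ and $e_x$ invertible. A coherent 2-group is a weak monoidal category in which every morphism is invertible and every object $x$ is equipped with an adjoint equivalence $(x,\bar{x},i_x,e_x)$. A weak monoidal functor $F\colon C\to C'$ is a functor with a natural isomorphism $F_2\colon F(x)\otimes F(y)\to F(x\otimes y)$ and an isomorphism $F_0\colon 1'\to F(1)$ satisfying the usual compatibility with the associators and the left and right unit isomorphisms (i.e. a strong monoidal functor). A weak monoidal natural transformation $\theta\colon F\Rightarrow G$ is a natural transformation with $G_2\circ(\theta_x\otimes\theta_y)=\theta_{x\otimes y}\circ F_2$ and $\theta_1\circ F_0=G_0$. A homomorphism between weak 2-groups, and likewise between coherent 2-groups, is a weak monoidal functor between the underlying weak monoidal categories; a 2-homomorphism between homomorphisms is a weak monoidal natural transformation. $\mathrm{W2G}$ (respectively $\mathrm{C2G}$) is the 2-category of weak (respectively coherent) 2-groups, homomorphisms between these, and 2-homomorphisms between those. *)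

theory Defs
  imports "HOL-Library.FuncSet"
begin

text \<open>
  Categories are small: objects and morphisms form sets in the types \<open>'o\<close> and \<open>'m\<close>.
  The operations of a category (and of a monoidal category) are unconstrained outside these
  sets.
\<close>

record ('o, 'm) cat =
  Obj :: "'o set"
  Mor :: "'m set"
  Dom :: "'m \<Rightarrow> 'o"
  Cod :: "'m \<Rightarrow> 'o"
  Idn :: "'o \<Rightarrow> 'm"
  Comp :: "'m \<Rightarrow> 'm \<Rightarrow> 'm"  (infixr "\<cdot>\<index>" 65)

definition Hom :: "('o, 'm, 'r) cat_scheme \<Rightarrow> 'o \<Rightarrow> 'o \<Rightarrow> 'm set"
  where "Hom C x y = {f \<in> Mor C. Dom C f = x \<and> Cod C f = y}"

locale category =
  fixes C :: "('o, 'm, 'r) cat_scheme" (structure)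
  assumes Dom_closed: "f \<in> Mor C \<Longrightarrow> Dom C f \<in> Obj C"
    and Cod_closed: "f \<in> Mor C \<Longrightarrow> Cod C f \<in> Obj C"
    and Idn_closed: "x \<in> Obj C \<Longrightarrow> Idn C x \<in> Hom C x x"
    and Comp_closed: "f \<in> Hom C x y \<Longrightarrow> g \<in> Hom C y z \<Longrightarrow> g \<cdot> f \<in> Hom C x z"
    and Comp_Idn: "f \<in> Hom C x y \<Longrightarrow> f \<cdot> Idn C x = f"
    and Idn_Comp: "f \<in> Hom C x y \<Longrightarrow> Idn C y \<cdot> f = f"
    and Comp_assoc: "f \<in> Hom C w x \<Longrightarrow> g \<in> Hom C x y \<Longrightarrow> h \<in> Hom C y z \<Longrightarrow>
      (h \<cdot> g) \<cdot> f = h \<cdot> (g \<cdot> f)"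

definition inverse_pair :: "('o, 'm, 'r) cat_scheme \<Rightarrow> 'm \<Rightarrow> 'm \<Rightarrow> bool"
  where "inverse_pair C f g \<longleftrightarrow> f \<in> Mor C \<and> g \<in> Hom C (Cod C f) (Dom C f) \<and>
    g \<cdot>\<^bsub>C\<^esub> f = Idn C (Dom C f) \<and> f \<cdot>\<^bsub>C\<^esub> g = Idn C (Cod C f)"

definition invertible :: "('o, 'm, 'r) cat_scheme \<Rightarrow> 'm \<Rightarrow> bool"
  where "invertible C f \<longleftrightarrow> (\<exists>g. inverse_pair C f g)"

definition inverse_of :: "('o, 'm, 'r) cat_scheme \<Rightarrow> 'm \<Rightarrow> 'm"
  where "inverse_of C f = (THE g. inverse_pair C f g)"

definition isomorphic :: "('o, 'm, 'r) cat_scheme \<Rightarrow> 'o \<Rightarrow> 'o \<Rightarrow> bool"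
  where "isomorphic C x y \<longleftrightarrow> (\<exists>f \<in> Hom C x y. invertible C f)"

definition prod_cat :: "('o, 'm, 'r) cat_scheme \<Rightarrow> ('p, 'n, 's) cat_scheme \<Rightarrow>
    ('o \<times> 'p, 'm \<times> 'n) cat"
  where "prod_cat C D = \<lparr>
    Obj = Obj C \<times> Obj D,
    Mor = Mor C \<times> Mor D,
    Dom = (\<lambda>(f, g). (Dom C f, Dom D g)),
    Cod = (\<lambda>(f, g). (Cod C f, Cod D g)),
    Idn = (\<lambda>(x, y). (Idn C x, Idn D y)),
    Comp = (\<lambda>(f', g') (f, g). (f' \<cdot>\<^bsub>C\<^esub> f, g' \<cdot>\<^bsub>D\<^esub> g)) \<rparr>"

record ('o, 'm, 'p, 'n) func =
  FOb :: "'o \<Rightarrow> 'p"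
  FMor :: "'m \<Rightarrow> 'n"

locale cat_functor = source: category C + target: category D
  for C :: "('o, 'm, 'r) cat_scheme" and D :: "('p, 'n, 's) cat_scheme" +
  fixes F :: "('o, 'm, 'p, 'n, 'u) func_scheme"
  assumes FOb_closed: "x \<in> Obj C \<Longrightarrow> FOb F x \<in> Obj D"
    and FMor_closed: "f \<in> Hom C x y \<Longrightarrow> FMor F f \<in> Hom D (FOb F x) (FOb F y)"
    and FMor_Idn: "x \<in> Obj C \<Longrightarrow> FMor F (Idn C x) = Idn D (FOb F x)"
    and FMor_Comp: "f \<in> Hom C x y \<Longrightarrow> g \<in> Hom C y z \<Longrightarrow>
      FMor F (g \<cdot>\<^bsub>C\<^esub> f) = FMor F g \<cdot>\<^bsub>D\<^esub> FMor F f"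

locale natural_transformation = F: cat_functor C D F + G: cat_functor C D G
  for C :: "('o, 'm, 'r) cat_scheme" and D :: "('p, 'n, 's) cat_scheme"
    and F :: "('o, 'm, 'p, 'n, 'u) func_scheme"
    and G :: "('o, 'm, 'p, 'n, 'v) func_scheme" +
  fixes \<theta> :: "'o \<Rightarrow> 'n"
  assumes component: "x \<in> Obj C \<Longrightarrow> \<theta> x \<in> Hom D (FOb F x) (FOb G x)"
    and naturality: "f \<in> Hom C x y \<Longrightarrow> \<theta> y \<cdot>\<^bsub>D\<^esub> FMor F f = FMor G f \<cdot>\<^bsub>D\<^esub> \<theta> x"

locale natural_isomorphism = natural_transformation +
  assumes component_invertible: "x \<in> Obj C \<Longrightarrow> invertible D (\<theta> x)"

record ('o, 'm) moncat = "('o, 'm) cat" +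
  Tensor :: "('o \<times> 'o, 'm \<times> 'm, 'o, 'm) func"
  Unit :: 'o  ("\<one>\<index>")
  Assoc :: "'o \<Rightarrow> 'o \<Rightarrow> 'o \<Rightarrow> 'm"
  LUnit :: "'o \<Rightarrow> 'm"
  RUnit :: "'o \<Rightarrow> 'm"

abbreviation tensor_obj :: "('o, 'm, 'r) moncat_scheme \<Rightarrow> 'o \<Rightarrow> 'o \<Rightarrow> 'o"  (infixl "\<otimes>\<index>" 70)
  where "tensor_obj M x y \<equiv> FOb (Tensor M) (x, y)"

abbreviation tensor_mor :: "('o, 'm, 'r) moncat_scheme \<Rightarrow> 'm \<Rightarrow> 'm \<Rightarrow> 'm"  (infixl "\<boxtimes>\<index>" 70)
  where "tensor_mor M f g \<equiv> FMor (Tensor M) (f, g)"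

locale monoidal_category = category M
  for M :: "('o, 'm, 'r) moncat_scheme" (structure) +
  assumes tensor_functor: "cat_functor (prod_cat M M) M (Tensor M)"
    and unit_closed: "\<one> \<in> Obj M"
    and assoc_iso: "natural_isomorphism (prod_cat (prod_cat M M) M) M
      \<lparr>FOb = (\<lambda>((x, y), z). (x \<otimes> y) \<otimes> z), FMor = (\<lambda>((f, g), h). (f \<boxtimes> g) \<boxtimes> h)\<rparr>
      \<lparr>FOb = (\<lambda>((x, y), z). x \<otimes> (y \<otimes> z)), FMor = (\<lambda>((f, g), h). f \<boxtimes> (g \<boxtimes> h))\<rparr>
      (\<lambda>((x, y), z). Assoc M x y z)"
    and lunit_iso: "natural_isomorphism M M
      \<lparr>FOb = (\<lambda>x. \<one> \<otimes> x), FMor = (\<lambda>f. Idn M \<one> \<boxtimes> f)\<rparr>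
      \<lparr>FOb = (\<lambda>x. x), FMor = (\<lambda>f. f)\<rparr>
      (LUnit M)"
    and runit_iso: "natural_isomorphism M M
      \<lparr>FOb = (\<lambda>x. x \<otimes> \<one>), FMor = (\<lambda>f. f \<boxtimes> Idn M \<one>)\<rparr>
      \<lparr>FOb = (\<lambda>x. x), FMor = (\<lambda>f. f)\<rparr>
      (RUnit M)"
    and pentagon: "w \<in> Obj M \<Longrightarrow> x \<in> Obj M \<Longrightarrow> y \<in> Obj M \<Longrightarrow> z \<in> Obj M \<Longrightarrow>
      (Idn M w \<boxtimes> Assoc M x y z) \<cdot> Assoc M w (x \<otimes> y) z \<cdot> (Assoc M w x y \<boxtimes> Idn M z)
        = Assoc M w x (y \<otimes> z) \<cdot> Assoc M (w \<otimes> x) y z"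
    and triangle: "x \<in> Obj M \<Longrightarrow> y \<in> Obj M \<Longrightarrow>
      (Idn M x \<boxtimes> LUnit M y) \<cdot> Assoc M x \<one> y = RUnit M x \<boxtimes> Idn M y"

definition weak_inverse :: "('o, 'm, 'r) moncat_scheme \<Rightarrow> 'o \<Rightarrow> 'o \<Rightarrow> bool"
  where "weak_inverse M x y \<longleftrightarrow> y \<in> Obj M \<and>
    isomorphic M (x \<otimes>\<^bsub>M\<^esub> y) \<one>\<^bsub>M\<^esub> \<and> isomorphic M (y \<otimes>\<^bsub>M\<^esub> x) \<one>\<^bsub>M\<^esub>"

definition weakly_invertible :: "('o, 'm, 'r) moncat_scheme \<Rightarrow> 'o \<Rightarrow> bool"
  where "weakly_invertible M x \<longleftrightarrow> (\<exists>y. weak_inverse M x y)"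

locale weak_2group = monoidal_category +
  assumes obj_weakly_invertible: "x \<in> Obj M \<Longrightarrow> weakly_invertible M x"
    and mor_invertible: "f \<in> Mor M \<Longrightarrow> invertible M f"

definition adjunction :: "('o, 'm, 'r) moncat_scheme \<Rightarrow> 'o \<Rightarrow> 'o \<Rightarrow> 'm \<Rightarrow> 'm \<Rightarrow> bool"
  where "adjunction M x x' i e \<longleftrightarrow>
    x \<in> Obj M \<and> x' \<in> Obj M \<and>
    i \<in> Hom M \<one>\<^bsub>M\<^esub> (x \<otimes>\<^bsub>M\<^esub> x') \<and> e \<in> Hom M (x' \<otimes>\<^bsub>M\<^esub> x) \<one>\<^bsub>M\<^esub> \<and>
    (Idn M x \<boxtimes>\<^bsub>M\<^esub> e) \<cdot>\<^bsub>M\<^esub> Assoc M x x' x \<cdot>\<^bsub>M\<^esub> (i \<boxtimes>\<^bsub>M\<^esub> Idn M x)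
      = inverse_of M (RUnit M x) \<cdot>\<^bsub>M\<^esub> LUnit M x \<and>
    (e \<boxtimes>\<^bsub>M\<^esub> Idn M x') \<cdot>\<^bsub>M\<^esub> inverse_of M (Assoc M x' x x') \<cdot>\<^bsub>M\<^esub> (Idn M x' \<boxtimes>\<^bsub>M\<^esub> i)
      = inverse_of M (LUnit M x') \<cdot>\<^bsub>M\<^esub> RUnit M x'"

definition adjoint_equivalence :: "('o, 'm, 'r) moncat_scheme \<Rightarrow> 'o \<Rightarrow> 'o \<Rightarrow> 'm \<Rightarrow> 'm \<Rightarrow> bool"
  where "adjoint_equivalence M x x' i e \<longleftrightarrow>
    adjunction M x x' i e \<and> invertible M i \<and> invertible M e"

record ('o, 'm) coh_moncat = "('o, 'm) moncat" +
  Dual :: "'o \<Rightarrow> 'o"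
  AdjUnit :: "'o \<Rightarrow> 'm"
  AdjCounit :: "'o \<Rightarrow> 'm"

locale coherent_2group = monoidal_category M
  for M :: "('o, 'm, 'r) coh_moncat_scheme" (structure) +
  assumes mor_invertible: "f \<in> Mor M \<Longrightarrow> invertible M f"
    and adjoint_equivalence: "x \<in> Obj M \<Longrightarrow>
      adjoint_equivalence M x (Dual M x) (AdjUnit M x) (AdjCounit M x)"

record ('o, 'm, 'p, 'n) mfunc = "('o, 'm, 'p, 'n) func" +
  F2 :: "'o \<times> 'o \<Rightarrow> 'n"
  F0 :: 'n

locale monoidal_functor =
  source: monoidal_category C + target: monoidal_category D + cat_functor C D F
  for C :: "('o, 'm, 'r) moncat_scheme" and D :: "('p, 'n, 's) moncat_scheme"
    and F :: "('o, 'm, 'p, 'n, 'u) mfunc_scheme" +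
  assumes F2_iso: "natural_isomorphism (prod_cat C C) D
      \<lparr>FOb = (\<lambda>(x, y). FOb F x \<otimes>\<^bsub>D\<^esub> FOb F y), FMor = (\<lambda>(f, g). FMor F f \<boxtimes>\<^bsub>D\<^esub> FMor F g)\<rparr>
      \<lparr>FOb = (\<lambda>(x, y). FOb F (x \<otimes>\<^bsub>C\<^esub> y)), FMor = (\<lambda>(f, g). FMor F (f \<boxtimes>\<^bsub>C\<^esub> g))\<rparr>
      (F2 F)"
    and F0_closed: "F0 F \<in> Hom D \<one>\<^bsub>D\<^esub> (FOb F \<one>\<^bsub>C\<^esub>)"
    and F0_invertible: "invertible D (F0 F)"
    and F_assoc: "x \<in> Obj C \<Longrightarrow> y \<in> Obj C \<Longrightarrow> z \<in> Obj C \<Longrightarrow>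
      FMor F (Assoc C x y z) \<cdot>\<^bsub>D\<^esub> F2 F (x \<otimes>\<^bsub>C\<^esub> y, z) \<cdot>\<^bsub>D\<^esub> (F2 F (x, y) \<boxtimes>\<^bsub>D\<^esub> Idn D (FOb F z))
        = F2 F (x, y \<otimes>\<^bsub>C\<^esub> z) \<cdot>\<^bsub>D\<^esub> (Idn D (FOb F x) \<boxtimes>\<^bsub>D\<^esub> F2 F (y, z))
            \<cdot>\<^bsub>D\<^esub> Assoc D (FOb F x) (FOb F y) (FOb F z)"
    and F_lunit: "x \<in> Obj C \<Longrightarrow>
      FMor F (LUnit C x) \<cdot>\<^bsub>D\<^esub> F2 F (\<one>\<^bsub>C\<^esub>, x) \<cdot>\<^bsub>D\<^esub> (F0 F \<boxtimes>\<^bsub>D\<^esub> Idn D (FOb F x))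
        = LUnit D (FOb F x)"
    and F_runit: "x \<in> Obj C \<Longrightarrow>
      FMor F (RUnit C x) \<cdot>\<^bsub>D\<^esub> F2 F (x, \<one>\<^bsub>C\<^esub>) \<cdot>\<^bsub>D\<^esub> (Idn D (FOb F x) \<boxtimes>\<^bsub>D\<^esub> F0 F)
        = RUnit D (FOb F x)"

locale monoidal_transformation =
  F: monoidal_functor C D F + G: monoidal_functor C D G + natural_transformation C D F G \<theta>
  for C :: "('o, 'm, 'r) moncat_scheme" and D :: "('p, 'n, 's) moncat_scheme"
    and F :: "('o, 'm, 'p, 'n, 'u) mfunc_scheme"
    and G :: "('o, 'm, 'p, 'n, 'v) mfunc_scheme"
    and \<theta> :: "'o \<Rightarrow> 'n" +
  assumes tensor_compat: "x \<in> Obj C \<Longrightarrow> y \<in> Obj C \<Longrightarrow>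
      F2 G (x, y) \<cdot>\<^bsub>D\<^esub> (\<theta> x \<boxtimes>\<^bsub>D\<^esub> \<theta> y) = \<theta> (x \<otimes>\<^bsub>C\<^esub> y) \<cdot>\<^bsub>D\<^esub> F2 F (x, y)"
    and unit_compat: "\<theta> \<one>\<^bsub>C\<^esub> \<cdot>\<^bsub>D\<^esub> F0 F = F0 G"

text \<open>
  A (strict) 2-category is a category enriched in categories: \<open>HomCat K A B\<close> has the 1-cells
  from \<open>A\<close> to \<open>B\<close> as objects and the 2-cells between these as morphisms, composed vertically,
  and \<open>HComp K A B C\<close> is composition of 1-cells and horizontal composition of 2-cells.
  Different hom categories need not be disjoint.
\<close>

record ('a, 'f, 't) two_cat =
  Ob :: "'a set"
  HomCat :: "'a \<Rightarrow> 'a \<Rightarrow> ('f, 't) cat"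
  Id1 :: "'a \<Rightarrow> 'f"
  HComp :: "'a \<Rightarrow> 'a \<Rightarrow> 'a \<Rightarrow> ('f \<times> 'f, 't \<times> 't, 'f, 't) func"

locale two_category =
  fixes K :: "('a, 'f, 't, 'r) two_cat_scheme"
  assumes hom_category: "A \<in> Ob K \<Longrightarrow> B \<in> Ob K \<Longrightarrow> category (HomCat K A B)"
    and Id1_closed: "A \<in> Ob K \<Longrightarrow> Id1 K A \<in> Obj (HomCat K A A)"
    and HComp_functor: "A \<in> Ob K \<Longrightarrow> B \<in> Ob K \<Longrightarrow> C \<in> Ob K \<Longrightarrow>
      cat_functor (prod_cat (HomCat K B C) (HomCat K A B)) (HomCat K A C) (HComp K A B C)"
    and HComp_assoc_1: "A \<in> Ob K \<Longrightarrow> B \<in> Ob K \<Longrightarrow> C \<in> Ob K \<Longrightarrow> D \<in> Ob K \<Longrightarrow>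
      f \<in> Obj (HomCat K A B) \<Longrightarrow> g \<in> Obj (HomCat K B C) \<Longrightarrow> h \<in> Obj (HomCat K C D) \<Longrightarrow>
      FOb (HComp K A B D) (FOb (HComp K B C D) (h, g), f)
        = FOb (HComp K A C D) (h, FOb (HComp K A B C) (g, f))"
    and HComp_assoc_2: "A \<in> Ob K \<Longrightarrow> B \<in> Ob K \<Longrightarrow> C \<in> Ob K \<Longrightarrow> D \<in> Ob K \<Longrightarrow>
      \<rho> \<in> Mor (HomCat K A B) \<Longrightarrow> \<sigma> \<in> Mor (HomCat K B C) \<Longrightarrow> \<tau> \<in> Mor (HomCat K C D) \<Longrightarrow>
      FMor (HComp K A B D) (FMor (HComp K B C D) (\<tau>, \<sigma>), \<rho>)
        = FMor (HComp K A C D) (\<tau>, FMor (HComp K A B C) (\<sigma>, \<rho>))"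
    and HComp_Id1_right_1: "A \<in> Ob K \<Longrightarrow> B \<in> Ob K \<Longrightarrow> f \<in> Obj (HomCat K A B) \<Longrightarrow>
      FOb (HComp K A A B) (f, Id1 K A) = f"
    and HComp_Id1_left_1: "A \<in> Ob K \<Longrightarrow> B \<in> Ob K \<Longrightarrow> f \<in> Obj (HomCat K A B) \<Longrightarrow>
      FOb (HComp K A B B) (Id1 K B, f) = f"
    and HComp_Id1_right_2: "A \<in> Ob K \<Longrightarrow> B \<in> Ob K \<Longrightarrow> \<sigma> \<in> Mor (HomCat K A B) \<Longrightarrow>
      FMor (HComp K A A B) (\<sigma>, Idn (HomCat K A A) (Id1 K A)) = \<sigma>"
    and HComp_Id1_left_2: "A \<in> Ob K \<Longrightarrow> B \<in> Ob K \<Longrightarrow> \<sigma> \<in> Mor (HomCat K A B) \<Longrightarrow>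
      FMor (HComp K A B B) (Idn (HomCat K B B) (Id1 K B), \<sigma>) = \<sigma>"

record ('a, 'f, 't, 'b, 'g, 'u) two_func =
  OnOb :: "'a \<Rightarrow> 'b"
  OnHom :: "'a \<Rightarrow> 'a \<Rightarrow> ('f, 't, 'g, 'u) func"

locale two_functor = source: two_category K + target: two_category L
  for K :: "('a, 'f, 't, 'r) two_cat_scheme" and L :: "('b, 'g, 'u, 's) two_cat_scheme" +
  fixes \<Phi> :: "('a, 'f, 't, 'b, 'g, 'u, 'v) two_func_scheme"
  assumes OnOb_closed: "A \<in> Ob K \<Longrightarrow> OnOb \<Phi> A \<in> Ob L"
    and OnHom_functor: "A \<in> Ob K \<Longrightarrow> B \<in> Ob K \<Longrightarrow>
      cat_functor (HomCat K A B) (HomCat L (OnOb \<Phi> A) (OnOb \<Phi> B)) (OnHom \<Phi> A B)"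
    and OnHom_Id1: "A \<in> Ob K \<Longrightarrow> FOb (OnHom \<Phi> A A) (Id1 K A) = Id1 L (OnOb \<Phi> A)"
    and OnHom_HComp_1: "A \<in> Ob K \<Longrightarrow> B \<in> Ob K \<Longrightarrow> C \<in> Ob K \<Longrightarrow>
      f \<in> Obj (HomCat K A B) \<Longrightarrow> g \<in> Obj (HomCat K B C) \<Longrightarrow>
      FOb (OnHom \<Phi> A C) (FOb (HComp K A B C) (g, f))
        = FOb (HComp L (OnOb \<Phi> A) (OnOb \<Phi> B) (OnOb \<Phi> C))
            (FOb (OnHom \<Phi> B C) g, FOb (OnHom \<Phi> A B) f)"
    and OnHom_HComp_2: "A \<in> Ob K \<Longrightarrow> B \<in> Ob K \<Longrightarrow> C \<in> Ob K \<Longrightarrow>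
      \<sigma> \<in> Mor (HomCat K A B) \<Longrightarrow> \<tau> \<in> Mor (HomCat K B C) \<Longrightarrow>
      FMor (OnHom \<Phi> A C) (FMor (HComp K A B C) (\<tau>, \<sigma>))
        = FMor (HComp L (OnOb \<Phi> A) (OnOb \<Phi> B) (OnOb \<Phi> C))
            (FMor (OnHom \<Phi> B C) \<tau>, FMor (OnHom \<Phi> A B) \<sigma>)"

text \<open>
  All component functions of 1-cells and 2-cells are required to be \<open>undefined\<close> outside their
  domains, so that equality of 1-cells and of 2-cells is equality of homomorphisms and of
  2-homomorphisms.
\<close>

definition mfunc_extensional :: "('o, 'm, 'r) cat_scheme \<Rightarrow> ('o, 'm, 'p, 'n, 'u) mfunc_scheme \<Rightarrow> bool"
  where "mfunc_extensional C F \<longleftrightarrow> FOb F \<in> extensional (Obj C) \<and>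
    FMor F \<in> extensional (Mor C) \<and> F2 F \<in> extensional (Obj C \<times> Obj C)"

definition mfunc_id :: "('o, 'm, 'r) moncat_scheme \<Rightarrow> ('o, 'm, 'o, 'm) mfunc"
  where "mfunc_id C = \<lparr>
    FOb = (\<lambda>x \<in> Obj C. x),
    FMor = (\<lambda>f \<in> Mor C. f),
    F2 = (\<lambda>(x, y) \<in> Obj C \<times> Obj C. Idn C (x \<otimes>\<^bsub>C\<^esub> y)),
    F0 = Idn C \<one>\<^bsub>C\<^esub> \<rparr>"

definition mfunc_comp :: "('o, 'm, 'r) cat_scheme \<Rightarrow> ('q, 'l, 's) cat_scheme \<Rightarrow>
    ('p, 'n, 'q, 'l) mfunc \<Rightarrow> ('o, 'm, 'p, 'n) mfunc \<Rightarrow> ('o, 'm, 'q, 'l) mfunc"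
  where "mfunc_comp C E G F = \<lparr>
    FOb = (\<lambda>x \<in> Obj C. FOb G (FOb F x)),
    FMor = (\<lambda>f \<in> Mor C. FMor G (FMor F f)),
    F2 = (\<lambda>(x, y) \<in> Obj C \<times> Obj C. FMor G (F2 F (x, y)) \<cdot>\<^bsub>E\<^esub> F2 G (FOb F x, FOb F y)),
    F0 = FMor G (F0 F) \<cdot>\<^bsub>E\<^esub> F0 G \<rparr>"

record ('o, 'm, 'p, 'n) mtrans =
  Src :: "('o, 'm, 'p, 'n) mfunc"
  Tgt :: "('o, 'm, 'p, 'n) mfunc"
  Cmp :: "'o \<Rightarrow> 'n"

definition mon_hom_cat :: "('o, 'm, 'r) moncat_scheme \<Rightarrow> ('p, 'n, 's) moncat_scheme \<Rightarrow>
    (('o, 'm, 'p, 'n) mfunc, ('o, 'm, 'p, 'n) mtrans) cat"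
  where "mon_hom_cat C D = \<lparr>
    Obj = {F. monoidal_functor C D F \<and> mfunc_extensional C F},
    Mor = {\<theta>. mfunc_extensional C (Src \<theta>) \<and> mfunc_extensional C (Tgt \<theta>) \<and>
               monoidal_transformation C D (Src \<theta>) (Tgt \<theta>) (Cmp \<theta>) \<and>
               Cmp \<theta> \<in> extensional (Obj C)},
    Dom = Src,
    Cod = Tgt,
    Idn = (\<lambda>F. \<lparr>Src = F, Tgt = F, Cmp = (\<lambda>x \<in> Obj C. Idn D (FOb F x))\<rparr>),
    Comp = (\<lambda>\<tau> \<sigma>. \<lparr>Src = Src \<sigma>, Tgt = Tgt \<tau>, Cmp = (\<lambda>x \<in> Obj C. Cmp \<tau> x \<cdot>\<^bsub>D\<^esub> Cmp \<sigma> x)\<rparr>) \<rparr>"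

definition mtrans_hcomp :: "('o, 'm, 'r) cat_scheme \<Rightarrow> ('q, 'l, 's) cat_scheme \<Rightarrow>
    ('p, 'n, 'q, 'l) mtrans \<Rightarrow> ('o, 'm, 'p, 'n) mtrans \<Rightarrow> ('o, 'm, 'q, 'l) mtrans"
  where "mtrans_hcomp C E \<tau> \<sigma> = \<lparr>
    Src = mfunc_comp C E (Src \<tau>) (Src \<sigma>),
    Tgt = mfunc_comp C E (Tgt \<tau>) (Tgt \<sigma>),
    Cmp = (\<lambda>x \<in> Obj C. Cmp \<tau> (FOb (Tgt \<sigma>) x) \<cdot>\<^bsub>E\<^esub> FMor (Src \<tau>) (Cmp \<sigma> x)) \<rparr>"

text \<open>
  The 2-category with the given monoidal categories (possibly with further structure) as
  objects, and all weak monoidal functors and weak monoidal natural transformations between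
  the underlying monoidal categories. The record scheme makes the definitions above apply to
  coherent 2-groups, ignoring the extra fields.
\<close>

definition mon_two_cat :: "('o, 'm, 'r) moncat_scheme set \<Rightarrow>
    (('o, 'm, 'r) moncat_scheme, ('o, 'm, 'o, 'm) mfunc, ('o, 'm, 'o, 'm) mtrans) two_cat"
  where "mon_two_cat S = \<lparr>
    Ob = S,
    HomCat = mon_hom_cat,
    Id1 = mfunc_id,
    HComp = (\<lambda>C D E. \<lparr>FOb = (\<lambda>(G, F). mfunc_comp C E G F),
                      FMor = (\<lambda>(\<tau>, \<sigma>). mtrans_hcomp C E \<tau> \<sigma>)\<rparr>) \<rparr>"

definition W2G ::
    "(('o, 'm) moncat, ('o, 'm, 'o, 'm) mfunc, ('o, 'm, 'o, 'm) mtrans) two_cat"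
  where "W2G = mon_two_cat {C. weak_2group C}"

definition C2G ::
    "(('o, 'm) coh_moncat, ('o, 'm, 'o, 'm) mfunc, ('o, 'm, 'o, 'm) mtrans) two_cat"
  where "C2G = mon_two_cat {C. coherent_2group C}"

end

theory Submission
  imports Defs
begin

text \<open>
  Let \<open>y\<close> be a weak inverse of \<open>x\<close> and fix an isomorphism \<open>i : \<one> \<rightarrow> x \<otimes> y\<close>. Since \<open>x \<otimes> -\<close> is fully
  faithful, the first zig-zag identity, solved for \<open>x \<otimes> e\<close>, defines a unique \<open>e : y \<otimes> x \<rightarrow> \<one>\<close>, and it
  suffices to check the second identity after tensoring with \<open>x\<close>. There it reduces to the agreement
  of the two maps \<open>T \<rightarrow> T \<otimes> T\<close> induced by \<open>i\<close>, where \<open>T = x \<otimes> y\<close>. Homomorphisms and 2-homomorphisms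
  do not refer to the chosen adjoint equivalences, so \<open>imp\<close> can be the identity on hom categories.
\<close>

section \<open>Categories\<close>

text \<open>The isomorphisms \<open>x \<otimes> y \<rightarrow> \<one>\<close> and
  \<open>y \<otimes> x \<rightarrow> \<one>\<close> that witness a weak inverse are unrelated to
  each other, and in general they satisfy the zig-zag identities only up to an automorphism. So one
  of them is inverted to give the unit \<open>i\<close>, and the other only serves to cancel
  \<open>x\<close>. Cancellation works because rebracketing followed by an isomorphism
  \<open>w \<otimes> x \<rightarrow> \<one>\<close> identifies
  \<open>w \<otimes> (x \<otimes> -)\<close> with the identity functor. This gives faithfulness of
  \<open>x \<otimes> -\<close>; fullness uses the isomorphism in the other order as well. The second
  zig-zag identity involves unit constraints at tensor products and at \<open>\<one>\<close>. The
  laws for these are not among the axioms, so they are derived from the pentagon and the triangle.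
  On the side of 2-categories the point is strictness: 1-cells and 2-cells are records of restricted
  functions, and the hom categories of \<open>W2G\<close> and \<open>C2G\<close> have the same type.
  They can therefore be equal, and the laws of a 2-functor hold as equations.\<close>

context category
begin

lemma Mor_Obj [simp]:
  assumes "f \<in> Mor C"
  shows "Dom C f \<in> Obj C" "Cod C f \<in> Obj C"
  using assms Dom_closed Cod_closed by auto

lemma Idn_simps [simp]:
  assumes "x \<in> Obj C"
  shows "Idn C x \<in> Mor C" "Dom C (Idn C x) = x" "Cod C (Idn C x) = x"
  using Idn_closed[OF assms] by (auto simp: Hom_def)

text \<open>The axioms type morphisms by \<open>Hom\<close>, where the middle object of a composite
  occurs only in the premises and would have to be guessed. Splitting the typing into
  \<open>Mor\<close>, \<open>Dom\<close> and \<open>Cod\<close> lets the simplifier compute it; the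
  primed rules and the introduction rules below have this form for the same reason.\<close>

lemma Comp_simps [simp]:
  assumes "f \<in> Mor C" "g \<in> Mor C" "Dom C g = Cod C f"
  shows "g \<cdot> f \<in> Mor C" "Dom C (g \<cdot> f) = Dom C f" "Cod C (g \<cdot> f) = Cod C g"
  using Comp_closed[of f "Dom C f" "Cod C f" g "Cod C g"] assms by (auto simp: Hom_def)

lemma Comp_Idn' [simp]: "f \<in> Mor C \<Longrightarrow> Dom C f = x \<Longrightarrow> f \<cdot> Idn C x = f"
  using Comp_Idn by (auto simp: Hom_def)

lemma Idn_Comp' [simp]: "f \<in> Mor C \<Longrightarrow> Cod C f = x \<Longrightarrow> Idn C x \<cdot> f = f"
  using Idn_Comp by (auto simp: Hom_def)

lemma Comp_assoc' [simp]:
  assumes "f \<in> Mor C" "g \<in> Mor C" "h \<in> Mor C" "Dom C g = Cod C f" "Dom C h = Cod C g"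
  shows "(h \<cdot> g) \<cdot> f = h \<cdot> (g \<cdot> f)"
  using assms Comp_assoc[of f "Dom C f" "Cod C f" g "Cod C g" h "Cod C h"] by (auto simp: Hom_def)

text \<open>Simplification nests composites to the right, so the left side
  \<open>g \<cdot> f\<close> of a known square no longer occurs as a subterm once something precedes
  it. This applies such a square at the head of a longer composite.\<close>

lemma Comp_eq_extend:
  assumes "g \<cdot> f = g' \<cdot> f'" "f \<in> Mor C" "g \<in> Mor C" "Dom C g = Cod C f"
    "f' \<in> Mor C" "g' \<in> Mor C" "Dom C g' = Cod C f'" "k \<in> Mor C" "Cod C k = Dom C f"
  shows "g \<cdot> (f \<cdot> k) = g' \<cdot> (f' \<cdot> k)"
proof -
  have "Dom C f' = Dom C f" using assms Comp_simps(2) by metis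
  then show ?thesis
    using assms Comp_assoc'[of k f g] Comp_assoc'[of k f' g'] by simp
qed

lemma inverse_pair_iff:
  "inverse_pair C f g \<longleftrightarrow> f \<in> Mor C \<and> g \<in> Mor C \<and> Dom C g = Cod C f \<and> Cod C g = Dom C f \<and>
    g \<cdot> f = Idn C (Dom C f) \<and> f \<cdot> g = Idn C (Cod C f)"
  by (auto simp: inverse_pair_def Hom_def)

lemma inverse_pair_unique:
  assumes "inverse_pair C f g" "inverse_pair C f h"
  shows "g = h"
proof -
  have "g = g \<cdot> (f \<cdot> h)" using assms by (simp add: inverse_pair_iff)
  also have "\<dots> = (g \<cdot> f) \<cdot> h"
    using assms by (intro Comp_assoc'[symmetric]) (auto simp: inverse_pair_iff)
  also have "\<dots> = h" using assms by (simp add: inverse_pair_iff)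
  finally show ?thesis .
qed

lemma inverse_of_eq: "inverse_pair C f g \<Longrightarrow> inverse_of C f = g"
  unfolding inverse_of_def using inverse_pair_unique by blast

lemma inverse_of_pair: "invertible C f \<Longrightarrow> inverse_pair C f (inverse_of C f)"
  unfolding invertible_def using inverse_of_eq by metis

lemma invertible_Mor: "invertible C f \<Longrightarrow> f \<in> Mor C"
  by (auto simp: invertible_def inverse_pair_iff)

lemma inverse_of_simps [simp]:
  assumes "invertible C f"
  shows "inverse_of C f \<in> Mor C"
    "Dom C (inverse_of C f) = Cod C f" "Cod C (inverse_of C f) = Dom C f"
    "inverse_of C f \<cdot> f = Idn C (Dom C f)" "f \<cdot> inverse_of C f = Idn C (Cod C f)"
  using inverse_of_pair[OF assms] by (auto simp: inverse_pair_iff)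

text \<open>In composites nested to the right, a morphism meets its inverse in front of a tail
  \<open>k\<close>, and cancellation has to be available in that shape.\<close>

lemma inverse_of_cancel [simp]:
  assumes "invertible C f" "k \<in> Mor C"
  shows "Cod C k = Dom C f \<Longrightarrow> inverse_of C f \<cdot> (f \<cdot> k) = k"
    "Cod C k = Cod C f \<Longrightarrow> f \<cdot> (inverse_of C f \<cdot> k) = k"
proof -
  note f = assms(1) invertible_Mor[OF assms(1)] assms(2)
  show "inverse_of C f \<cdot> (f \<cdot> k) = k" if "Cod C k = Dom C f"
    using that f Comp_assoc'[of k f "inverse_of C f"] by simp
  show "f \<cdot> (inverse_of C f \<cdot> k) = k" if "Cod C k = Cod C f"
    using that f Comp_assoc'[of k "inverse_of C f" f] by simp
qed

lemma invertible_inverse_of [simp]: "invertible C f \<Longrightarrow> invertible C (inverse_of C f)"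
  unfolding invertible_def[of C "inverse_of C f"]
  by (rule exI[of _ f]) (simp add: inverse_pair_iff invertible_Mor)

lemma invertible_Comp [simp]:
  assumes "invertible C f" "invertible C g" "Dom C g = Cod C f"
  shows "invertible C (g \<cdot> f)"
  unfolding invertible_def
  by (rule exI[of _ "inverse_of C f \<cdot> inverse_of C g"]) (simp add: assms invertible_Mor inverse_pair_iff)

lemma invertible_Idn [simp]: "x \<in> Obj C \<Longrightarrow> invertible C (Idn C x)"
  unfolding invertible_def by (rule exI[of _ "Idn C x"]) (simp add: inverse_pair_iff)

lemma inverse_of_Idn [simp]: "x \<in> Obj C \<Longrightarrow> inverse_of C (Idn C x) = Idn C x"
  by (rule inverse_of_eq) (simp add: inverse_pair_iff)

lemma invertible_cancel_left:
  assumes "invertible C h" "h \<cdot> f = h \<cdot> g" "f \<in> Mor C" "g \<in> Mor C"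
    "Cod C f = Dom C h" "Cod C g = Dom C h"
  shows "f = g"
proof -
  have "f = inverse_of C h \<cdot> (h \<cdot> f)" "g = inverse_of C h \<cdot> (h \<cdot> g)"
    using assms(1,3-) by simp_all
  then show ?thesis using assms(2) by metis
qed

lemma invertible_cancel_right:
  assumes "invertible C h" "f \<cdot> h = g \<cdot> h" "f \<in> Mor C" "g \<in> Mor C"
    "Dom C f = Cod C h" "Dom C g = Cod C h"
  shows "f = g"
proof -
  have "f = (f \<cdot> h) \<cdot> inverse_of C h" "g = (g \<cdot> h) \<cdot> inverse_of C h"
    using assms(1,3-) by (simp_all add: invertible_Mor)
  then show ?thesis using assms(2) by metis
qed

end

section \<open>Product categories, functors and natural transformations\<close>

lemma prod_cat_simps [simp]:
  "Obj (prod_cat C D) = Obj C \<times> Obj D" "Mor (prod_cat C D) = Mor C \<times> Mor D"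
  "Dom (prod_cat C D) (f, g) = (Dom C f, Dom D g)"
  "Cod (prod_cat C D) (f, g) = (Cod C f, Cod D g)"
  "Idn (prod_cat C D) (x, y) = (Idn C x, Idn D y)"
  "Comp (prod_cat C D) (f', g') (f, g) = (f' \<cdot>\<^bsub>C\<^esub> f, g' \<cdot>\<^bsub>D\<^esub> g)"
  by (auto simp: prod_cat_def)

lemma prod_category: "category C \<Longrightarrow> category D \<Longrightarrow> category (prod_cat C D)"
  by unfold_locales (auto simp: Hom_def category.Comp_assoc' category.Mor_Obj category.Idn_simps
    category.Comp_simps category.Comp_Idn' category.Idn_Comp')

context cat_functor
begin

lemma FMor_simps [simp]:
  assumes "f \<in> Mor C"
  shows "FMor F f \<in> Mor D" "Dom D (FMor F f) = FOb F (Dom C f)" "Cod D (FMor F f) = FOb F (Cod C f)"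
  using FMor_closed[of f "Dom C f" "Cod C f"] assms by (auto simp: Hom_def)

lemma FMor_Comp':
  assumes "f \<in> Mor C" "g \<in> Mor C" "Dom C g = Cod C f"
  shows "FMor F (g \<cdot>\<^bsub>C\<^esub> f) = FMor F g \<cdot>\<^bsub>D\<^esub> FMor F f"
  using FMor_Comp[of f "Dom C f" "Cod C f" g "Cod C g"] assms by (auto simp: Hom_def)

declare FOb_closed [simp] FMor_Idn [simp] FMor_Comp' [simp]

lemma FMor_invertible [simp]:
  assumes "invertible C f"
  shows "invertible D (FMor F f)"
proof -
  obtain g where g: "inverse_pair C f g" using assms by (auto simp: invertible_def)
  have "inverse_pair D (FMor F f) (FMor F g)"
    using g by (simp add: source.inverse_pair_iff target.inverse_pair_iff flip: FMor_Comp')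
  then show ?thesis by (auto simp: invertible_def)
qed

end

lemma cat_functorI:
  assumes "category C" "category D"
    "\<And>x. x \<in> Obj C \<Longrightarrow> FOb F x \<in> Obj D"
    "\<And>f. f \<in> Mor C \<Longrightarrow> FMor F f \<in> Mor D"
    "\<And>f. f \<in> Mor C \<Longrightarrow> Dom D (FMor F f) = FOb F (Dom C f)"
    "\<And>f. f \<in> Mor C \<Longrightarrow> Cod D (FMor F f) = FOb F (Cod C f)"
    "\<And>x. x \<in> Obj C \<Longrightarrow> FMor F (Idn C x) = Idn D (FOb F x)"
    "\<And>f g. f \<in> Mor C \<Longrightarrow> g \<in> Mor C \<Longrightarrow> Dom C g = Cod C f \<Longrightarrow>
      FMor F (g \<cdot>\<^bsub>C\<^esub> f) = FMor F g \<cdot>\<^bsub>D\<^esub> FMor F f"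
  shows "cat_functor C D F"
  using assms by (intro cat_functor.intro cat_functor_axioms.intro) (auto simp: Hom_def)

context natural_transformation
begin

lemma component_simps [simp]:
  assumes "x \<in> Obj C"
  shows "\<theta> x \<in> Mor D" "Dom D (\<theta> x) = FOb F x" "Cod D (\<theta> x) = FOb G x"
  using component[OF assms] by (auto simp: Hom_def)

lemma naturality':
  "f \<in> Mor C \<Longrightarrow> \<theta> (Cod C f) \<cdot>\<^bsub>D\<^esub> FMor F f = FMor G f \<cdot>\<^bsub>D\<^esub> \<theta> (Dom C f)"
  using naturality[of f "Dom C f" "Cod C f"] by (auto simp: Hom_def)

end

lemma natural_transformationI:
  assumes "cat_functor C D F" "cat_functor C D G"
    "\<And>x. x \<in> Obj C \<Longrightarrow> \<theta> x \<in> Mor D"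
    "\<And>x. x \<in> Obj C \<Longrightarrow> Dom D (\<theta> x) = FOb F x"
    "\<And>x. x \<in> Obj C \<Longrightarrow> Cod D (\<theta> x) = FOb G x"
    "\<And>f. f \<in> Mor C \<Longrightarrow> \<theta> (Cod C f) \<cdot>\<^bsub>D\<^esub> FMor F f = FMor G f \<cdot>\<^bsub>D\<^esub> \<theta> (Dom C f)"
  shows "natural_transformation C D F G \<theta>"
  using assms
  by (intro natural_transformation.intro natural_transformation_axioms.intro) (auto simp: Hom_def)

lemma natural_isomorphismI:
  assumes "natural_transformation C D F G \<theta>" "\<And>x. x \<in> Obj C \<Longrightarrow> invertible D (\<theta> x)"
  shows "natural_isomorphism C D F G \<theta>"
  using assms by (intro natural_isomorphism.intro natural_isomorphism_axioms.intro)

section \<open>Monoidal categories\<close>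

context monoidal_category
begin

declare unit_closed [simp]

lemma tensor_closed [simp]: "x \<in> Obj M \<Longrightarrow> y \<in> Obj M \<Longrightarrow> x \<otimes> y \<in> Obj M"
  using cat_functor.FOb_closed[OF tensor_functor, of "(x, y)"] by simp

lemma tensor_simps [simp]:
  assumes "f \<in> Mor M" "g \<in> Mor M"
  shows "f \<boxtimes> g \<in> Mor M" "Dom M (f \<boxtimes> g) = Dom M f \<otimes> Dom M g" "Cod M (f \<boxtimes> g) = Cod M f \<otimes> Cod M g"
  using cat_functor.FMor_simps[OF tensor_functor, of "(f, g)"] assms by simp_all

lemma tensor_Idn [simp]: "x \<in> Obj M \<Longrightarrow> y \<in> Obj M \<Longrightarrow> Idn M x \<boxtimes> Idn M y = Idn M (x \<otimes> y)"
  using cat_functor.FMor_Idn[OF tensor_functor, of "(x, y)"] by simp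

lemma interchange:
  assumes "f \<in> Mor M" "g \<in> Mor M" "f' \<in> Mor M" "g' \<in> Mor M" "Dom M g = Cod M f" "Dom M g' = Cod M f'"
  shows "(g \<boxtimes> g') \<cdot> (f \<boxtimes> f') = (g \<cdot> f) \<boxtimes> (g' \<cdot> f')"
  using cat_functor.FMor_Comp'[OF tensor_functor, of "(f, f')" "(g, g')"] assms by simp

lemma invertible_tensor [simp]:
  assumes "invertible M f" "invertible M g"
  shows "invertible M (f \<boxtimes> g)"
  unfolding invertible_def
  by (rule exI[of _ "inverse_of M f \<boxtimes> inverse_of M g"])
    (simp add: assms invertible_Mor inverse_pair_iff interchange)

lemma inverse_of_tensor:
  assumes "invertible M f" "invertible M g"
  shows "inverse_of M (f \<boxtimes> g) = inverse_of M f \<boxtimes> inverse_of M g"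
  by (rule inverse_of_eq) (simp add: assms invertible_Mor inverse_pair_iff interchange)

lemma Assoc_simps [simp]:
  assumes "x \<in> Obj M" "y \<in> Obj M" "z \<in> Obj M"
  shows "Assoc M x y z \<in> Mor M" "Dom M (Assoc M x y z) = (x \<otimes> y) \<otimes> z"
    "Cod M (Assoc M x y z) = x \<otimes> (y \<otimes> z)" "invertible M (Assoc M x y z)"
proof -
  interpret natural_isomorphism "prod_cat (prod_cat M M) M" M
      "\<lparr>FOb = (\<lambda>((x, y), z). (x \<otimes> y) \<otimes> z), FMor = (\<lambda>((f, g), h). (f \<boxtimes> g) \<boxtimes> h)\<rparr>"
      "\<lparr>FOb = (\<lambda>((x, y), z). x \<otimes> (y \<otimes> z)), FMor = (\<lambda>((f, g), h). f \<boxtimes> (g \<boxtimes> h))\<rparr>"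
      "\<lambda>((x, y), z). Assoc M x y z"
    by (rule assoc_iso)
  show "Assoc M x y z \<in> Mor M" "Dom M (Assoc M x y z) = (x \<otimes> y) \<otimes> z"
    "Cod M (Assoc M x y z) = x \<otimes> (y \<otimes> z)" "invertible M (Assoc M x y z)"
    using component_simps[of "((x, y), z)"] component_invertible[of "((x, y), z)"] assms
    by simp_all
qed

lemma Assoc_natural:
  assumes "f \<in> Mor M" "g \<in> Mor M" "h \<in> Mor M"
  shows "Assoc M (Cod M f) (Cod M g) (Cod M h) \<cdot> ((f \<boxtimes> g) \<boxtimes> h)
    = (f \<boxtimes> (g \<boxtimes> h)) \<cdot> Assoc M (Dom M f) (Dom M g) (Dom M h)"
proof -
  interpret natural_isomorphism "prod_cat (prod_cat M M) M" M
      "\<lparr>FOb = (\<lambda>((x, y), z). (x \<otimes> y) \<otimes> z), FMor = (\<lambda>((f, g), h). (f \<boxtimes> g) \<boxtimes> h)\<rparr>"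
      "\<lparr>FOb = (\<lambda>((x, y), z). x \<otimes> (y \<otimes> z)), FMor = (\<lambda>((f, g), h). f \<boxtimes> (g \<boxtimes> h))\<rparr>"
      "\<lambda>((x, y), z). Assoc M x y z"
    by (rule assoc_iso)
  show ?thesis using naturality'[of "((f, g), h)"] assms by simp
qed

lemma LUnit_simps [simp]:
  assumes "x \<in> Obj M"
  shows "LUnit M x \<in> Mor M" "Dom M (LUnit M x) = \<one> \<otimes> x" "Cod M (LUnit M x) = x"
    "invertible M (LUnit M x)"
proof -
  interpret natural_isomorphism M M
      "\<lparr>FOb = (\<lambda>x. \<one> \<otimes> x), FMor = (\<lambda>f. Idn M \<one> \<boxtimes> f)\<rparr>"
      "\<lparr>FOb = (\<lambda>x. x), FMor = (\<lambda>f. f)\<rparr>" "LUnit M"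
    by (rule lunit_iso)
  show "LUnit M x \<in> Mor M" "Dom M (LUnit M x) = \<one> \<otimes> x" "Cod M (LUnit M x) = x"
    "invertible M (LUnit M x)"
    using component_simps[of x] component_invertible[of x] assms by simp_all
qed

lemma LUnit_natural:
  assumes "f \<in> Mor M"
  shows "LUnit M (Cod M f) \<cdot> (Idn M \<one> \<boxtimes> f) = f \<cdot> LUnit M (Dom M f)"
proof -
  interpret natural_isomorphism M M
      "\<lparr>FOb = (\<lambda>x. \<one> \<otimes> x), FMor = (\<lambda>f. Idn M \<one> \<boxtimes> f)\<rparr>"
      "\<lparr>FOb = (\<lambda>x. x), FMor = (\<lambda>f. f)\<rparr>" "LUnit M"
    by (rule lunit_iso)
  show ?thesis using naturality'[of f] assms by simp
qed

lemma RUnit_simps [simp]: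
  assumes "x \<in> Obj M"
  shows "RUnit M x \<in> Mor M" "Dom M (RUnit M x) = x \<otimes> \<one>" "Cod M (RUnit M x) = x"
    "invertible M (RUnit M x)"
proof -
  interpret natural_isomorphism M M
      "\<lparr>FOb = (\<lambda>x. x \<otimes> \<one>), FMor = (\<lambda>f. f \<boxtimes> Idn M \<one>)\<rparr>"
      "\<lparr>FOb = (\<lambda>x. x), FMor = (\<lambda>f. f)\<rparr>" "RUnit M"
    by (rule runit_iso)
  show "RUnit M x \<in> Mor M" "Dom M (RUnit M x) = x \<otimes> \<one>" "Cod M (RUnit M x) = x"
    "invertible M (RUnit M x)"
    using component_simps[of x] component_invertible[of x] assms by simp_all
qed

lemma RUnit_natural:
  assumes "f \<in> Mor M"
  shows "RUnit M (Cod M f) \<cdot> (f \<boxtimes> Idn M \<one>) = f \<cdot> RUnit M (Dom M f)"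
proof -
  interpret natural_isomorphism M M
      "\<lparr>FOb = (\<lambda>x. x \<otimes> \<one>), FMor = (\<lambda>f. f \<boxtimes> Idn M \<one>)\<rparr>"
      "\<lparr>FOb = (\<lambda>x. x), FMor = (\<lambda>f. f)\<rparr>" "RUnit M"
    by (rule runit_iso)
  show ?thesis using naturality'[of f] assms by simp
qed

section \<open>Coherence laws for the unit constraints\<close>

text \<open>By naturality of the invertible \<open>LUnit\<close>, the morphism \<open>f\<close> is
  conjugate to \<open>\<one> \<otimes> f\<close> and hence determined by it.\<close>

lemma unit_tensor_faithful:
  assumes "Idn M \<one> \<boxtimes> f = Idn M \<one> \<boxtimes> g" "f \<in> Mor M" "g \<in> Mor M" "Dom M f = Dom M g" "Cod M f = Cod M g"
  shows "f = g"
proof (rule invertible_cancel_right[of "LUnit M (Dom M f)"])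
  show "f \<cdot> LUnit M (Dom M f) = g \<cdot> LUnit M (Dom M f)"
    using assms LUnit_natural[of f] LUnit_natural[of g] by metis
qed (use assms in simp_all)

lemma tensor_unit_faithful:
  assumes "f \<boxtimes> Idn M \<one> = g \<boxtimes> Idn M \<one>" "f \<in> Mor M" "g \<in> Mor M" "Dom M f = Dom M g" "Cod M f = Cod M g"
  shows "f = g"
proof (rule invertible_cancel_right[of "RUnit M (Dom M f)"])
  show "f \<cdot> RUnit M (Dom M f) = g \<cdot> RUnit M (Dom M f)"
    using assms RUnit_natural[of f] RUnit_natural[of g] by metis
qed (use assms in simp_all)

lemma whisker_left_Comp:
  assumes "f \<in> Mor M" "g \<in> Mor M" "Dom M g = Cod M f" "x \<in> Obj M"
  shows "Idn M x \<boxtimes> (g \<cdot> f) = (Idn M x \<boxtimes> g) \<cdot> (Idn M x \<boxtimes> f)"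
  using assms by (simp add: interchange)

lemma whisker_right_Comp:
  assumes "f \<in> Mor M" "g \<in> Mor M" "Dom M g = Cod M f" "x \<in> Obj M"
  shows "(g \<cdot> f) \<boxtimes> Idn M x = (g \<boxtimes> Idn M x) \<cdot> (f \<boxtimes> Idn M x)"
  using assms by (simp add: interchange)

text \<open>
  The next three facts are Kelly's redundant coherence axioms. As \<open>\<one> \<otimes> -\<close> and \<open>- \<otimes> \<one>\<close> are
  faithful, the pentagon and the triangle imply them.
\<close>

lemma LUnit_tensor:
  assumes [simp]: "x \<in> Obj M" "y \<in> Obj M"
  shows "LUnit M (x \<otimes> y) \<cdot> Assoc M \<one> x y = LUnit M x \<boxtimes> Idn M y"
proof (rule unit_tensor_faithful)
  \<comment> \<open>The first two arrows of the three-arrow side of the pentagon on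
    \<open>\<one>\<close>, \<open>\<one>\<close>, \<open>x\<close>, \<open>y\<close>. The third
    arrow is \<open>\<one> \<otimes> Assoc M \<one> x y\<close>, which the claim provides after
    tensoring with \<open>\<one>\<close>.\<close>
  let ?Q = "Assoc M \<one> (\<one> \<otimes> x) y \<cdot> (Assoc M \<one> \<one> x \<boxtimes> Idn M y)"
  show "Idn M \<one> \<boxtimes> (LUnit M (x \<otimes> y) \<cdot> Assoc M \<one> x y) = Idn M \<one> \<boxtimes> (LUnit M x \<boxtimes> Idn M y)"
  proof (rule invertible_cancel_right[of ?Q])
    have "(Idn M \<one> \<boxtimes> (LUnit M (x \<otimes> y) \<cdot> Assoc M \<one> x y)) \<cdot> ?Q
        = (Idn M \<one> \<boxtimes> LUnit M (x \<otimes> y)) \<cdot> ((Idn M \<one> \<boxtimes> Assoc M \<one> x y) \<cdot> ?Q)"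
      by (simp add: whisker_left_Comp)
    also have "\<dots> = (Idn M \<one> \<boxtimes> LUnit M (x \<otimes> y)) \<cdot> (Assoc M \<one> \<one> (x \<otimes> y) \<cdot> Assoc M (\<one> \<otimes> \<one>) x y)"
      using pentagon[of \<one> \<one> x y] by simp
    also have "\<dots> = ((Idn M \<one> \<boxtimes> LUnit M (x \<otimes> y)) \<cdot> Assoc M \<one> \<one> (x \<otimes> y)) \<cdot> Assoc M (\<one> \<otimes> \<one>) x y"
      by simp
    also have "\<dots> = (RUnit M \<one> \<boxtimes> (Idn M x \<boxtimes> Idn M y)) \<cdot> Assoc M (\<one> \<otimes> \<one>) x y"
      by (simp only: triangle tensor_closed unit_closed assms tensor_Idn)
    also have "\<dots> = Assoc M \<one> x y \<cdot> ((RUnit M \<one> \<boxtimes> Idn M x) \<boxtimes> Idn M y)"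
      using Assoc_natural[of "RUnit M \<one>" "Idn M x" "Idn M y"] by simp
    \<comment> \<open>The triangle on \<open>\<one>\<close> and \<open>x\<close>, used backwards and
      tensored with \<open>y\<close>, recovers the factor
      \<open>Assoc M \<one> \<one> x \<boxtimes> Idn M y\<close> of \<open>?Q\<close>.\<close>
    also have "\<dots> = Assoc M \<one> x y \<cdot> (((Idn M \<one> \<boxtimes> LUnit M x) \<cdot> Assoc M \<one> \<one> x) \<boxtimes> Idn M y)"
      by (simp only: triangle unit_closed assms)
    also have "\<dots> = Assoc M \<one> x y \<cdot> (((Idn M \<one> \<boxtimes> LUnit M x) \<boxtimes> Idn M y) \<cdot> (Assoc M \<one> \<one> x \<boxtimes> Idn M y))"
      by (simp add: whisker_right_Comp)
    also have "\<dots> = (Idn M \<one> \<boxtimes> (LUnit M x \<boxtimes> Idn M y)) \<cdot> ?Q"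
      using Assoc_natural[of "Idn M \<one>" "LUnit M x" "Idn M y"] by (intro Comp_eq_extend) simp_all
    finally show "(Idn M \<one> \<boxtimes> (LUnit M (x \<otimes> y) \<cdot> Assoc M \<one> x y)) \<cdot> ?Q
        = (Idn M \<one> \<boxtimes> (LUnit M x \<boxtimes> Idn M y)) \<cdot> ?Q" .
  qed simp_all
qed simp_all

lemma RUnit_tensor:
  assumes [simp]: "x \<in> Obj M" "y \<in> Obj M"
  shows "(Idn M x \<boxtimes> RUnit M y) \<cdot> Assoc M x y \<one> = RUnit M (x \<otimes> y)"
proof (rule tensor_unit_faithful)
  let ?a = "Assoc M x y \<one>"
  show "((Idn M x \<boxtimes> RUnit M y) \<cdot> ?a) \<boxtimes> Idn M \<one> = RUnit M (x \<otimes> y) \<boxtimes> Idn M \<one>"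
  proof (rule invertible_cancel_left[of ?a])
    \<comment> \<open>With \<open>?a\<close> in front, naturality of the associator moves
      \<open>RUnit M y \<boxtimes> Idn M \<one>\<close> inside the bracket. There the triangle on
      \<open>y\<close> and \<open>\<one>\<close> applies, and then the pentagon on \<open>x\<close>,
      \<open>y\<close>, \<open>\<one>\<close>, \<open>\<one>\<close>.\<close>
    have "?a \<cdot> (((Idn M x \<boxtimes> RUnit M y) \<cdot> ?a) \<boxtimes> Idn M \<one>)
        = ?a \<cdot> (((Idn M x \<boxtimes> RUnit M y) \<boxtimes> Idn M \<one>) \<cdot> (?a \<boxtimes> Idn M \<one>))"
      by (simp add: whisker_right_Comp)
    also have "\<dots> = (Idn M x \<boxtimes> (RUnit M y \<boxtimes> Idn M \<one>)) \<cdot> (Assoc M x (y \<otimes> \<one>) \<one> \<cdot> (?a \<boxtimes> Idn M \<one>))"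
      using Assoc_natural[of "Idn M x" "RUnit M y" "Idn M \<one>"] by (intro Comp_eq_extend) simp_all
    also have "\<dots> = (Idn M x \<boxtimes> ((Idn M y \<boxtimes> LUnit M \<one>) \<cdot> Assoc M y \<one> \<one>)) \<cdot>
        (Assoc M x (y \<otimes> \<one>) \<one> \<cdot> (?a \<boxtimes> Idn M \<one>))"
      by (simp only: triangle unit_closed assms)
    also have "\<dots> = (Idn M x \<boxtimes> (Idn M y \<boxtimes> LUnit M \<one>)) \<cdot> ((Idn M x \<boxtimes> Assoc M y \<one> \<one>) \<cdot>
        (Assoc M x (y \<otimes> \<one>) \<one> \<cdot> (?a \<boxtimes> Idn M \<one>)))"
      by (simp add: whisker_left_Comp)
    also have "\<dots> = (Idn M x \<boxtimes> (Idn M y \<boxtimes> LUnit M \<one>)) \<cdot> (Assoc M x y (\<one> \<otimes> \<one>) \<cdot> Assoc M (x \<otimes> y) \<one> \<one>)"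
      using pentagon[of x y \<one> \<one>] by simp
    also have "\<dots> = ?a \<cdot> (((Idn M x \<boxtimes> Idn M y) \<boxtimes> LUnit M \<one>) \<cdot> Assoc M (x \<otimes> y) \<one> \<one>)"
      using Assoc_natural[of "Idn M x" "Idn M y" "LUnit M \<one>"]
      by (intro Comp_eq_extend[symmetric]) simp_all
    also have "\<dots> = ?a \<cdot> (RUnit M (x \<otimes> y) \<boxtimes> Idn M \<one>)"
      by (simp only: tensor_Idn triangle unit_closed tensor_closed assms)
    finally show "?a \<cdot> (((Idn M x \<boxtimes> RUnit M y) \<cdot> ?a) \<boxtimes> Idn M \<one>)
        = ?a \<cdot> (RUnit M (x \<otimes> y) \<boxtimes> Idn M \<one>)" .
  qed simp_all
qed simp_all

lemma LUnit_unit: "LUnit M \<one> = RUnit M \<one>"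
proof (rule tensor_unit_faithful)
  \<comment> \<open>Naturality of \<open>LUnit\<close> at its own component at
    \<open>\<one>\<close>. It gives \<open>LUnit_tensor\<close> and the triangle on
    \<open>\<one>\<close>, \<open>\<one>\<close> the same left-hand side.\<close>
  have "Idn M \<one> \<boxtimes> LUnit M \<one> = LUnit M (\<one> \<otimes> \<one>)"
  proof (rule invertible_cancel_left[of "LUnit M \<one>"])
    show "LUnit M \<one> \<cdot> (Idn M \<one> \<boxtimes> LUnit M \<one>) = LUnit M \<one> \<cdot> LUnit M (\<one> \<otimes> \<one>)"
      using LUnit_natural[of "LUnit M \<one>"] by (simp only: LUnit_simps unit_closed)
  qed simp_all
  then show "LUnit M \<one> \<boxtimes> Idn M \<one> = RUnit M \<one> \<boxtimes> Idn M \<one>"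
    using LUnit_tensor[of \<one> \<one>] triangle[of \<one> \<one>] by simp
qed simp_all

section \<open>Weakly invertible objects\<close>

text \<open>The map \<open>\<kappa> u\<close> is the path from
  \<open>w \<otimes> (x \<otimes> u)\<close> through \<open>(w \<otimes> x) \<otimes> u\<close> and
  \<open>\<one> \<otimes> u\<close> to \<open>u\<close>. Each leg is natural in \<open>u\<close>, so
  tensoring with \<open>x\<close> can be undone by tensoring with \<open>w\<close>.\<close>

lemma tensor_cancel_natural_iso:
  assumes w: "w \<in> Obj M" and x: "x \<in> Obj M"
    and \<phi>: "invertible M \<phi>" "Dom M \<phi> = w \<otimes> x" "Cod M \<phi> = \<one>"
  obtains \<kappa> where "\<And>u. u \<in> Obj M \<Longrightarrow> invertible M (\<kappa> u)"
    "\<And>u. u \<in> Obj M \<Longrightarrow> Dom M (\<kappa> u) = w \<otimes> (x \<otimes> u)"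
    "\<And>u. u \<in> Obj M \<Longrightarrow> Cod M (\<kappa> u) = u"
    "\<And>k. k \<in> Mor M \<Longrightarrow>
      \<kappa> (Cod M k) \<cdot> (Idn M w \<boxtimes> (Idn M x \<boxtimes> k)) = k \<cdot> \<kappa> (Dom M k)"
proof -
  note [simp] = w x \<phi> invertible_Mor[OF \<phi>(1)]
  define \<kappa> where "\<kappa> u = LUnit M u \<cdot> ((\<phi> \<boxtimes> Idn M u) \<cdot> inverse_of M (Assoc M w x u))" for u
  have 1: "invertible M (\<kappa> u)" "Dom M (\<kappa> u) = w \<otimes> (x \<otimes> u)" "Cod M (\<kappa> u) = u"
    if "u \<in> Obj M" for u
    using that by (simp_all add: \<kappa>_def)
  have 2: "\<kappa> (Cod M k) \<cdot> (Idn M w \<boxtimes> (Idn M x \<boxtimes> k)) = k \<cdot> \<kappa> (Dom M k)" if [simp]: "k \<in> Mor M" for k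
  proof -
    let ?a = "Assoc M w x (Dom M k)" and ?b = "Assoc M w x (Cod M k)"
    let ?k = "Idn M w \<boxtimes> (Idn M x \<boxtimes> k)"
    have 3: "?b \<cdot> ((Idn M w \<boxtimes> Idn M x) \<boxtimes> k) = ?k \<cdot> ?a"
      using Assoc_natural[of "Idn M w" "Idn M x" k] by simp
    have "inverse_of M ?b \<cdot> ?k = inverse_of M ?b \<cdot> ((?k \<cdot> ?a) \<cdot> inverse_of M ?a)"
      by simp
    also have "\<dots> = ((Idn M w \<boxtimes> Idn M x) \<boxtimes> k) \<cdot> inverse_of M ?a"
      unfolding 3[symmetric] by simp
    finally have 4: "inverse_of M ?b \<cdot> ?k = ((Idn M w \<boxtimes> Idn M x) \<boxtimes> k) \<cdot> inverse_of M ?a" .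
    have 5: "(\<phi> \<boxtimes> Idn M (Cod M k)) \<cdot> (Idn M (w \<otimes> x) \<boxtimes> k) = (Idn M \<one> \<boxtimes> k) \<cdot> (\<phi> \<boxtimes> Idn M (Dom M k))"
      by (simp add: interchange)
    have "\<kappa> (Cod M k) \<cdot> ?k
        = LUnit M (Cod M k) \<cdot> ((\<phi> \<boxtimes> Idn M (Cod M k)) \<cdot> (inverse_of M ?b \<cdot> ?k))"
      by (simp add: \<kappa>_def)
    also have "\<dots> = LUnit M (Cod M k) \<cdot> (((\<phi> \<boxtimes> Idn M (Cod M k)) \<cdot> (Idn M (w \<otimes> x) \<boxtimes> k)) \<cdot> inverse_of M ?a)"
      by (simp add: 4)
    also have "\<dots> = LUnit M (Cod M k) \<cdot> (((Idn M \<one> \<boxtimes> k) \<cdot> (\<phi> \<boxtimes> Idn M (Dom M k))) \<cdot> inverse_of M ?a)"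
      unfolding 5 ..
    also have "\<dots> = (LUnit M (Cod M k) \<cdot> (Idn M \<one> \<boxtimes> k)) \<cdot> ((\<phi> \<boxtimes> Idn M (Dom M k)) \<cdot> inverse_of M ?a)"
      by simp
    also have "\<dots> = k \<cdot> \<kappa> (Dom M k)"
      by (simp only: LUnit_natural that) (simp add: \<kappa>_def)
    finally show ?thesis .
  qed
  from that[of \<kappa>] 1 2 show ?thesis by blast
qed

text \<open>By \<open>\<kappa>\<close>, each \<open>f\<close> is conjugate to
  \<open>w \<otimes> (x \<otimes> f)\<close>, which depends only on
  \<open>x \<otimes> f\<close>.\<close>

lemma tensor_left_faithful:
  assumes w: "w \<in> Obj M" and x: "x \<in> Obj M"
    and \<phi>: "invertible M \<phi>" "Dom M \<phi> = w \<otimes> x" "Cod M \<phi> = \<one>"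
    and fg: "f \<in> Mor M" "g \<in> Mor M" "Dom M f = Dom M g" "Cod M f = Cod M g"
    and eq: "Idn M x \<boxtimes> f = Idn M x \<boxtimes> g"
  shows "f = g"
proof -
  obtain \<kappa> where \<kappa>: "\<And>u. u \<in> Obj M \<Longrightarrow> invertible M (\<kappa> u)"
      "\<And>u. u \<in> Obj M \<Longrightarrow> Cod M (\<kappa> u) = u"
      "\<And>k. k \<in> Mor M \<Longrightarrow> \<kappa> (Cod M k) \<cdot> (Idn M w \<boxtimes> (Idn M x \<boxtimes> k)) = k \<cdot> \<kappa> (Dom M k)"
    using tensor_cancel_natural_iso[OF w x \<phi>] by metis
  show ?thesis
  proof (rule invertible_cancel_right[of "\<kappa> (Dom M f)"])
    show "f \<cdot> \<kappa> (Dom M f) = g \<cdot> \<kappa> (Dom M f)"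
      using \<kappa>(3)[of f] \<kappa>(3)[of g] fg eq by metis
  qed (use \<kappa> fg in simp_all)
qed

lemma tensor_left_full:
  assumes w: "w \<in> Obj M" and x: "x \<in> Obj M"
    and \<phi>: "invertible M \<phi>" "Dom M \<phi> = w \<otimes> x" "Cod M \<phi> = \<one>"
    and \<psi>: "invertible M \<psi>" "Dom M \<psi> = x \<otimes> w" "Cod M \<psi> = \<one>"
    and uv: "u \<in> Obj M" "v \<in> Obj M"
    and h: "h \<in> Mor M" "Dom M h = x \<otimes> u" "Cod M h = x \<otimes> v"
  obtains k where "k \<in> Mor M" "Dom M k = u" "Cod M k = v" "Idn M x \<boxtimes> k = h"
proof -
  obtain \<kappa> where \<kappa>: "\<And>u. u \<in> Obj M \<Longrightarrow> invertible M (\<kappa> u)"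
      "\<And>u. u \<in> Obj M \<Longrightarrow> Dom M (\<kappa> u) = w \<otimes> (x \<otimes> u)"
      "\<And>u. u \<in> Obj M \<Longrightarrow> Cod M (\<kappa> u) = u"
      "\<And>k. k \<in> Mor M \<Longrightarrow> \<kappa> (Cod M k) \<cdot> (Idn M w \<boxtimes> (Idn M x \<boxtimes> k)) = k \<cdot> \<kappa> (Dom M k)"
    using tensor_cancel_natural_iso[OF w x \<phi>] by metis
  note [simp] = w x uv h \<kappa>(1-3) invertible_Mor[OF \<kappa>(1)]
  \<comment> \<open>If \<open>x \<otimes> k = h\<close>, then naturality of \<open>\<kappa>\<close>
    forces this formula.\<close>
  define k where "k = \<kappa> v \<cdot> ((Idn M w \<boxtimes> h) \<cdot> inverse_of M (\<kappa> u))"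
  have k [simp]: "k \<in> Mor M" "Dom M k = u" "Cod M k = v"
    by (simp_all add: k_def)
  have "\<kappa> v \<cdot> (Idn M w \<boxtimes> (Idn M x \<boxtimes> k)) = k \<cdot> \<kappa> u"
    using \<kappa>(4)[of k] by simp
  also have "\<dots> = \<kappa> v \<cdot> (Idn M w \<boxtimes> h)"
    by (simp add: k_def)
  finally have "Idn M w \<boxtimes> (Idn M x \<boxtimes> k) = Idn M w \<boxtimes> h"
    by (rule invertible_cancel_left[rotated]) simp_all
  \<comment> \<open>Here \<open>w\<close> has to be stripped off, so faithfulness is used with
    \<open>x\<close> and \<open>w\<close> exchanged; this is the place for
    \<open>\<psi> : x \<otimes> w \<rightarrow> \<one>\<close>.\<close>
  then have "Idn M x \<boxtimes> k = h"
    by (intro tensor_left_faithful[OF x w \<psi>, of "Idn M x \<boxtimes> k" h]) simp_all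
  then show ?thesis using that k by blast
qed

text \<open>Both sides agree after precomposition with \<open>i\<close>, where both become \<open>i \<otimes> i\<close>.\<close>

lemma unit_whisker_commute:
  assumes [simp]: "T \<in> Obj M" and i: "invertible M i" "Dom M i = \<one>" "Cod M i = T"
  shows "(Idn M T \<boxtimes> i) \<cdot> inverse_of M (RUnit M T) = (i \<boxtimes> Idn M T) \<cdot> inverse_of M (LUnit M T)"
proof -
  note [simp] = i invertible_Mor[OF i(1)]
  have r: "inverse_of M (RUnit M T) \<cdot> i = (i \<boxtimes> Idn M \<one>) \<cdot> inverse_of M (RUnit M \<one>)"
  proof -
    have "inverse_of M (RUnit M T) \<cdot> i = inverse_of M (RUnit M T) \<cdot> ((i \<cdot> RUnit M \<one>) \<cdot> inverse_of M (RUnit M \<one>))"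
      by simp
    also have "i \<cdot> RUnit M \<one> = RUnit M T \<cdot> (i \<boxtimes> Idn M \<one>)"
      using RUnit_natural[of i] by simp
    finally show ?thesis by simp
  qed
  have l: "inverse_of M (LUnit M T) \<cdot> i = (Idn M \<one> \<boxtimes> i) \<cdot> inverse_of M (LUnit M \<one>)"
  proof -
    have "inverse_of M (LUnit M T) \<cdot> i = inverse_of M (LUnit M T) \<cdot> ((i \<cdot> LUnit M \<one>) \<cdot> inverse_of M (LUnit M \<one>))"
      by simp
    also have "i \<cdot> LUnit M \<one> = LUnit M T \<cdot> (Idn M \<one> \<boxtimes> i)"
      using LUnit_natural[of i] by simp
    finally show ?thesis by simp
  qed
  have "((Idn M T \<boxtimes> i) \<cdot> inverse_of M (RUnit M T)) \<cdot> i
      = ((Idn M T \<boxtimes> i) \<cdot> (i \<boxtimes> Idn M \<one>)) \<cdot> inverse_of M (RUnit M \<one>)"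
    by (simp add: r)
  \<comment> \<open>Besides interchange, this needs the two unit constraints at
    \<open>\<one>\<close> to coincide, which is \<open>LUnit_unit\<close>.\<close>
  also have "\<dots> = ((i \<boxtimes> Idn M T) \<cdot> (Idn M \<one> \<boxtimes> i)) \<cdot> inverse_of M (LUnit M \<one>)"
    by (simp add: interchange LUnit_unit)
  also have "\<dots> = ((i \<boxtimes> Idn M T) \<cdot> inverse_of M (LUnit M T)) \<cdot> i"
    by (simp add: l)
  finally show ?thesis
    by (rule invertible_cancel_right[rotated]) simp_all
qed

text \<open>
  Tensoring the second identity with \<open>x\<close> on the left loses no information, and the first one
  then expresses \<open>x \<otimes> (e \<otimes> y)\<close> through the inverse of \<open>i\<close>.
\<close>

lemma zigzag_from_other:
  assumes x [simp]: "x \<in> Obj M" and y [simp]: "y \<in> Obj M"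
    and i: "invertible M i" "Dom M i = \<one>" "Cod M i = x \<otimes> y"
    and e: "invertible M e" "Dom M e = y \<otimes> x" "Cod M e = \<one>"
    and zigzag: "(Idn M x \<boxtimes> e) \<cdot> Assoc M x y x \<cdot> (i \<boxtimes> Idn M x) = inverse_of M (RUnit M x) \<cdot> LUnit M x"
  shows "(e \<boxtimes> Idn M y) \<cdot> inverse_of M (Assoc M y x y) \<cdot> (Idn M y \<boxtimes> i)
    = inverse_of M (LUnit M y) \<cdot> RUnit M y" (is "?L = ?R")
\<comment> \<open>The isomorphism \<open>y \<otimes> x \<rightarrow> \<one>\<close> that allows
  cancelling \<open>x\<close> is \<open>e\<close> itself.\<close>
proof (rule tensor_left_faithful[OF y x e])
  note [simp] = i invertible_Mor[OF i(1)] e invertible_Mor[OF e(1)]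
  let ?T = "x \<otimes> y" and ?x = "Idn M x" and ?y = "Idn M y" and ?A = "Assoc M y x y"
  \<comment> \<open>After tensoring with \<open>x\<close>, both sides start at
    \<open>x \<otimes> (y \<otimes> \<one>)\<close>; \<open>?c\<close> is the isomorphism from
    \<open>?T\<close> to this object. It is the form in which \<open>RUnit_tensor\<close> and
    naturality at \<open>i\<close> apply.\<close>
  let ?c = "Assoc M x y \<one> \<cdot> inverse_of M (RUnit M ?T)"
  \<comment> \<open>The first zig-zag tensored with \<open>y\<close> on the right, stopped before
    \<open>e\<close> acts, and rebracketed so as to end at
    \<open>x \<otimes> ((y \<otimes> x) \<otimes> y)\<close>. This is where both
    \<open>x \<otimes> (e \<otimes> y)\<close> and \<open>x \<otimes> ?A\<close> start.\<close>
  let ?B = "Assoc M x (y \<otimes> x) y \<cdot> ((Assoc M x y x \<boxtimes> ?y) \<cdot> ((i \<boxtimes> ?x) \<boxtimes> ?y))"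
  \<comment> \<open>Continuing \<open>?B\<close> by \<open>e\<close> completes the first zig-zag;
    the triangle then absorbs the remaining associator and \<open>RUnit M x\<close>.\<close>
  have B1: "(?x \<boxtimes> (e \<boxtimes> ?y)) \<cdot> ?B = inverse_of M (?x \<boxtimes> LUnit M y) \<cdot> (LUnit M x \<boxtimes> ?y)"
  proof -
    have "(?x \<boxtimes> (e \<boxtimes> ?y)) \<cdot> ?B
        = Assoc M x \<one> y \<cdot> (((?x \<boxtimes> e) \<boxtimes> ?y) \<cdot> ((Assoc M x y x \<boxtimes> ?y) \<cdot> ((i \<boxtimes> ?x) \<boxtimes> ?y)))"
      using Assoc_natural[of ?x e ?y] by (intro Comp_eq_extend) simp_all
    also have "\<dots> = Assoc M x \<one> y \<cdot> (((?x \<boxtimes> e) \<cdot> Assoc M x y x \<cdot> (i \<boxtimes> ?x)) \<boxtimes> ?y)"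
      by (simp add: whisker_right_Comp)
    also have "\<dots> = Assoc M x \<one> y \<cdot> (inverse_of M (RUnit M x \<boxtimes> ?y) \<cdot> (LUnit M x \<boxtimes> ?y))"
      unfolding zigzag by (simp add: whisker_right_Comp inverse_of_tensor)
    also have "\<dots> = inverse_of M (?x \<boxtimes> LUnit M y) \<cdot> ((((?x \<boxtimes> LUnit M y) \<cdot> Assoc M x \<one> y) \<cdot>
        inverse_of M (RUnit M x \<boxtimes> ?y)) \<cdot> (LUnit M x \<boxtimes> ?y))"
      by simp
    also have "\<dots> = inverse_of M (?x \<boxtimes> LUnit M y) \<cdot> (LUnit M x \<boxtimes> ?y)"
      unfolding triangle[OF x y] by simp
    finally show ?thesis .
  qed
  \<comment> \<open>Continuing \<open>?B\<close> by \<open>?A\<close> completes one side of the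
    pentagon on \<open>x\<close>, \<open>y\<close>, \<open>x\<close>, \<open>y\<close>, so only
    \<open>i\<close> whiskered by \<open>?T\<close> on the right is left, up to
    rebracketing.\<close>
  have B2: "(?x \<boxtimes> ?A) \<cdot> ?B = Assoc M x y ?T \<cdot> ((i \<boxtimes> Idn M ?T) \<cdot> Assoc M \<one> x y)"
  proof -
    have "(?x \<boxtimes> ?A) \<cdot> ?B
        = ((?x \<boxtimes> ?A) \<cdot> Assoc M x (y \<otimes> x) y \<cdot> (Assoc M x y x \<boxtimes> ?y)) \<cdot> ((i \<boxtimes> ?x) \<boxtimes> ?y)"
      by simp
    also have "\<dots> = Assoc M x y ?T \<cdot> (Assoc M ?T x y \<cdot> ((i \<boxtimes> ?x) \<boxtimes> ?y))"
      by (simp only: pentagon x y) simp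
    also have "\<dots> = Assoc M x y ?T \<cdot> ((i \<boxtimes> Idn M ?T) \<cdot> Assoc M \<one> x y)"
      using Assoc_natural[of i ?x ?y] by simp
    finally show ?thesis .
  qed
  \<comment> \<open>The second zig-zag inserts \<open>i\<close> on the right of \<open>?T\<close>,
    while \<open>?B\<close> inserts it on the left. \<open>unit_whisker_commute\<close> trades one
    for the other, so the second zig-zag factors through \<open>?B\<close>.\<close>
  have B3: "(?x \<boxtimes> (?y \<boxtimes> i)) \<cdot> ?c
      = (?x \<boxtimes> ?A) \<cdot> (?B \<cdot> (inverse_of M (Assoc M \<one> x y) \<cdot> inverse_of M (LUnit M ?T)))"
  proof -
    have "(?x \<boxtimes> (?y \<boxtimes> i)) \<cdot> ?c = Assoc M x y ?T \<cdot> ((Idn M ?T \<boxtimes> i) \<cdot> inverse_of M (RUnit M ?T))"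
      using Assoc_natural[of ?x ?y i] by (intro Comp_eq_extend) simp_all
    also have "\<dots> = (Assoc M x y ?T \<cdot> ((i \<boxtimes> Idn M ?T) \<cdot> Assoc M \<one> x y)) \<cdot>
        (inverse_of M (Assoc M \<one> x y) \<cdot> inverse_of M (LUnit M ?T))"
      using unit_whisker_commute[of ?T i] by simp
    also have "\<dots> = (?x \<boxtimes> ?A) \<cdot> (?B \<cdot> (inverse_of M (Assoc M \<one> x y) \<cdot> inverse_of M (LUnit M ?T)))"
      unfolding B2[symmetric] by simp
    finally show ?thesis .
  qed
  show "?x \<boxtimes> ?L = ?x \<boxtimes> ?R"
  proof (rule invertible_cancel_right[of ?c])
    have "(?x \<boxtimes> ?L) \<cdot> ?c
        = (?x \<boxtimes> (e \<boxtimes> ?y)) \<cdot> (inverse_of M (?x \<boxtimes> ?A) \<cdot> ((?x \<boxtimes> (?y \<boxtimes> i)) \<cdot> ?c))"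
      by (simp add: whisker_left_Comp inverse_of_tensor)
    also have "\<dots> = ((?x \<boxtimes> (e \<boxtimes> ?y)) \<cdot> ?B) \<cdot> (inverse_of M (Assoc M \<one> x y) \<cdot> inverse_of M (LUnit M ?T))"
      unfolding B3 by simp
    \<comment> \<open>The remaining left unit constraints cancel by \<open>LUnit_tensor\<close>; on
      the right-hand side of the claim \<open>RUnit_tensor\<close> does the same for the right ones,
      and both sides become this map.\<close>
    also have "\<dots> = inverse_of M (?x \<boxtimes> LUnit M y)"
      unfolding B1 LUnit_tensor[OF x y, symmetric] by simp
    also have "\<dots> = inverse_of M (?x \<boxtimes> LUnit M y) \<cdot> (((?x \<boxtimes> RUnit M y) \<cdot> Assoc M x y \<one>) \<cdot> inverse_of M (RUnit M ?T))"
      unfolding RUnit_tensor[OF x y] by simp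
    also have "\<dots> = (?x \<boxtimes> ?R) \<cdot> ?c"
      by (simp add: whisker_left_Comp inverse_of_tensor)
    finally show "(?x \<boxtimes> ?L) \<cdot> ?c = (?x \<boxtimes> ?R) \<cdot> ?c" .
  qed simp_all
qed (use i e invertible_Mor[OF i(1)] invertible_Mor[OF e(1)] in simp_all)

end

text \<open>Of the two given isomorphisms, \<open>\<psi>\<close> supplies the unit, and both
  together make \<open>x \<otimes> -\<close> full. The counit is built anew, since
  \<open>\<phi>\<close> need not be compatible with \<open>i\<close>.\<close>

lemma (in weak_2group) exists_adjoint_equivalence:
  assumes x [simp]: "x \<in> Obj M"
  shows "\<exists>y i e. adjoint_equivalence M x y i e"
proof -
  obtain y \<psi> \<phi> where y [simp]: "y \<in> Obj M"
    and \<psi>: "invertible M \<psi>" "Dom M \<psi> = x \<otimes> y" "Cod M \<psi> = \<one>"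
    and \<phi>: "invertible M \<phi>" "Dom M \<phi> = y \<otimes> x" "Cod M \<phi> = \<one>"
    using obj_weakly_invertible[OF x]
    by (auto simp: weakly_invertible_def weak_inverse_def isomorphic_def Hom_def)
  define i where "i = inverse_of M \<psi>"
  have i [simp]: "invertible M i" "Dom M i = \<one>" "Cod M i = x \<otimes> y" "i \<in> Mor M"
    using \<psi> by (simp_all add: i_def)
  \<comment> \<open>The value that the first zig-zag identity prescribes for
    \<open>Idn M x \<boxtimes> e\<close>.\<close>
  let ?h = "(inverse_of M (RUnit M x) \<cdot> LUnit M x) \<cdot>
    (inverse_of M (i \<boxtimes> Idn M x) \<cdot> inverse_of M (Assoc M x y x))"
  obtain e where e [simp]: "e \<in> Mor M" "Dom M e = y \<otimes> x" "Cod M e = \<one>" and h: "Idn M x \<boxtimes> e = ?h"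
    by (rule tensor_left_full[OF y x \<phi> \<psi>, of "y \<otimes> x" \<one> ?h]) simp_all
  \<comment> \<open>Fullness yields just a morphism \<open>e\<close>; its invertibility comes from
    the 2-group axiom on morphisms.\<close>
  have e_inv: "invertible M e" by (rule mor_invertible) simp
  have "(Idn M x \<boxtimes> e) \<cdot> Assoc M x y x \<cdot> (i \<boxtimes> Idn M x) = inverse_of M (RUnit M x) \<cdot> LUnit M x"
    unfolding h by simp
  then have "adjoint_equivalence M x y i e"
    using zigzag_from_other[OF x y i(1-3) e_inv e(2,3)] e_inv
    by (simp add: adjoint_equivalence_def adjunction_def Hom_def)
  then show ?thesis by blast
qed

section \<open>Monoidal functors and transformations\<close>

context monoidal_functor
begin

lemma F2_simps [simp]:
  assumes "x \<in> Obj C" "y \<in> Obj C"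
  shows "F2 F (x, y) \<in> Mor D" "Dom D (F2 F (x, y)) = FOb F x \<otimes>\<^bsub>D\<^esub> FOb F y"
    "Cod D (F2 F (x, y)) = FOb F (x \<otimes>\<^bsub>C\<^esub> y)" "invertible D (F2 F (x, y))"
proof -
  interpret F2: natural_isomorphism "prod_cat C C" D
      "\<lparr>FOb = (\<lambda>(x, y). FOb F x \<otimes>\<^bsub>D\<^esub> FOb F y), FMor = (\<lambda>(f, g). FMor F f \<boxtimes>\<^bsub>D\<^esub> FMor F g)\<rparr>"
      "\<lparr>FOb = (\<lambda>(x, y). FOb F (x \<otimes>\<^bsub>C\<^esub> y)), FMor = (\<lambda>(f, g). FMor F (f \<boxtimes>\<^bsub>C\<^esub> g))\<rparr>"
      "F2 F"
    by (rule F2_iso)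
  show "F2 F (x, y) \<in> Mor D" "Dom D (F2 F (x, y)) = FOb F x \<otimes>\<^bsub>D\<^esub> FOb F y"
    "Cod D (F2 F (x, y)) = FOb F (x \<otimes>\<^bsub>C\<^esub> y)" "invertible D (F2 F (x, y))"
    using F2.component_simps[of "(x, y)"] F2.component_invertible[of "(x, y)"] assms by simp_all
qed

lemma F2_natural:
  assumes "f \<in> Mor C" "g \<in> Mor C"
  shows "F2 F (Cod C f, Cod C g) \<cdot>\<^bsub>D\<^esub> (FMor F f \<boxtimes>\<^bsub>D\<^esub> FMor F g)
    = FMor F (f \<boxtimes>\<^bsub>C\<^esub> g) \<cdot>\<^bsub>D\<^esub> F2 F (Dom C f, Dom C g)"
proof -
  interpret F2: natural_isomorphism "prod_cat C C" D
      "\<lparr>FOb = (\<lambda>(x, y). FOb F x \<otimes>\<^bsub>D\<^esub> FOb F y), FMor = (\<lambda>(f, g). FMor F f \<boxtimes>\<^bsub>D\<^esub> FMor F g)\<rparr>"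
      "\<lparr>FOb = (\<lambda>(x, y). FOb F (x \<otimes>\<^bsub>C\<^esub> y)), FMor = (\<lambda>(f, g). FMor F (f \<boxtimes>\<^bsub>C\<^esub> g))\<rparr>"
      "F2 F"
    by (rule F2_iso)
  show ?thesis using F2.naturality'[of "(f, g)"] assms by simp
qed

lemma F0_simps [simp]:
  "F0 F \<in> Mor D" "Dom D (F0 F) = \<one>\<^bsub>D\<^esub>" "Cod D (F0 F) = FOb F \<one>\<^bsub>C\<^esub>" "invertible D (F0 F)"
  using F0_closed F0_invertible by (auto simp: Hom_def)

end

lemma monoidal_functorI:
  assumes C: "monoidal_category C" and D: "monoidal_category D" and F: "cat_functor C D F"
    and F2: "\<And>x y. x \<in> Obj C \<Longrightarrow> y \<in> Obj C \<Longrightarrow> invertible D (F2 F (x, y))"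
      "\<And>x y. x \<in> Obj C \<Longrightarrow> y \<in> Obj C \<Longrightarrow> Dom D (F2 F (x, y)) = FOb F x \<otimes>\<^bsub>D\<^esub> FOb F y"
      "\<And>x y. x \<in> Obj C \<Longrightarrow> y \<in> Obj C \<Longrightarrow> Cod D (F2 F (x, y)) = FOb F (x \<otimes>\<^bsub>C\<^esub> y)"
      "\<And>f g. f \<in> Mor C \<Longrightarrow> g \<in> Mor C \<Longrightarrow>
        F2 F (Cod C f, Cod C g) \<cdot>\<^bsub>D\<^esub> (FMor F f \<boxtimes>\<^bsub>D\<^esub> FMor F g)
          = FMor F (f \<boxtimes>\<^bsub>C\<^esub> g) \<cdot>\<^bsub>D\<^esub> F2 F (Dom C f, Dom C g)"
    and F0: "invertible D (F0 F)" "Dom D (F0 F) = \<one>\<^bsub>D\<^esub>" "Cod D (F0 F) = FOb F \<one>\<^bsub>C\<^esub>"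
    and coh: "\<And>x y z. x \<in> Obj C \<Longrightarrow> y \<in> Obj C \<Longrightarrow> z \<in> Obj C \<Longrightarrow>
        FMor F (Assoc C x y z) \<cdot>\<^bsub>D\<^esub> F2 F (x \<otimes>\<^bsub>C\<^esub> y, z) \<cdot>\<^bsub>D\<^esub> (F2 F (x, y) \<boxtimes>\<^bsub>D\<^esub> Idn D (FOb F z))
          = F2 F (x, y \<otimes>\<^bsub>C\<^esub> z) \<cdot>\<^bsub>D\<^esub> (Idn D (FOb F x) \<boxtimes>\<^bsub>D\<^esub> F2 F (y, z))
              \<cdot>\<^bsub>D\<^esub> Assoc D (FOb F x) (FOb F y) (FOb F z)"
      "\<And>x. x \<in> Obj C \<Longrightarrow>
        FMor F (LUnit C x) \<cdot>\<^bsub>D\<^esub> F2 F (\<one>\<^bsub>C\<^esub>, x) \<cdot>\<^bsub>D\<^esub> (F0 F \<boxtimes>\<^bsub>D\<^esub> Idn D (FOb F x)) = LUnit D (FOb F x)"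
      "\<And>x. x \<in> Obj C \<Longrightarrow>
        FMor F (RUnit C x) \<cdot>\<^bsub>D\<^esub> F2 F (x, \<one>\<^bsub>C\<^esub>) \<cdot>\<^bsub>D\<^esub> (Idn D (FOb F x) \<boxtimes>\<^bsub>D\<^esub> F0 F) = RUnit D (FOb F x)"
  shows "monoidal_functor C D F"
proof -
  interpret C: monoidal_category C by (rule C)
  interpret D: monoidal_category D by (rule D)
  interpret F: cat_functor C D F by (rule F)
  have CC: "category (prod_cat C C)"
    by (intro prod_category C.category_axioms)
  \<comment> \<open>For functoriality of the two composites with the tensor, interchange is used in
    opposite directions: it merges composites in \<open>D\<close>, and splits them in
    \<open>C\<close>, since \<open>F\<close> distributes over composites but not over
    tensors.\<close>
  have "natural_isomorphism (prod_cat C C) D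
      \<lparr>FOb = (\<lambda>(x, y). FOb F x \<otimes>\<^bsub>D\<^esub> FOb F y), FMor = (\<lambda>(f, g). FMor F f \<boxtimes>\<^bsub>D\<^esub> FMor F g)\<rparr>
      \<lparr>FOb = (\<lambda>(x, y). FOb F (x \<otimes>\<^bsub>C\<^esub> y)), FMor = (\<lambda>(f, g). FMor F (f \<boxtimes>\<^bsub>C\<^esub> g))\<rparr>
      (F2 F)"
    by (intro natural_isomorphismI natural_transformationI cat_functorI CC D.category_axioms)
      (auto simp: F2 D.invertible_Mor D.interchange simp flip: C.interchange)
  then show ?thesis
    using F0 coh D.invertible_Mor[OF F0(1)]
    by (intro monoidal_functor.intro monoidal_functor_axioms.intro C D F) (auto simp: Hom_def)
qed

lemma monoidal_transformationI:
  assumes "monoidal_functor C D F" "monoidal_functor C D G"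
    "\<And>x. x \<in> Obj C \<Longrightarrow> \<theta> x \<in> Mor D"
    "\<And>x. x \<in> Obj C \<Longrightarrow> Dom D (\<theta> x) = FOb F x"
    "\<And>x. x \<in> Obj C \<Longrightarrow> Cod D (\<theta> x) = FOb G x"
    "\<And>f. f \<in> Mor C \<Longrightarrow> \<theta> (Cod C f) \<cdot>\<^bsub>D\<^esub> FMor F f = FMor G f \<cdot>\<^bsub>D\<^esub> \<theta> (Dom C f)"
    "\<And>x y. x \<in> Obj C \<Longrightarrow> y \<in> Obj C \<Longrightarrow>
      F2 G (x, y) \<cdot>\<^bsub>D\<^esub> (\<theta> x \<boxtimes>\<^bsub>D\<^esub> \<theta> y) = \<theta> (x \<otimes>\<^bsub>C\<^esub> y) \<cdot>\<^bsub>D\<^esub> F2 F (x, y)"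
    "\<theta> \<one>\<^bsub>C\<^esub> \<cdot>\<^bsub>D\<^esub> F0 F = F0 G"
  shows "monoidal_transformation C D F G \<theta>"
  using assms
  by (intro monoidal_transformation.intro monoidal_transformation_axioms.intro natural_transformationI)
    (auto simp: monoidal_functor_def)

lemma mfunc_eqI:
  fixes F G :: "('o, 'm, 'p, 'n) mfunc"
  assumes "mfunc_extensional C F" "mfunc_extensional C G"
    "\<And>x. x \<in> Obj C \<Longrightarrow> FOb F x = FOb G x" "\<And>f. f \<in> Mor C \<Longrightarrow> FMor F f = FMor G f"
    "\<And>x y. x \<in> Obj C \<Longrightarrow> y \<in> Obj C \<Longrightarrow> F2 F (x, y) = F2 G (x, y)" "F0 F = F0 G"
  shows "F = G"
proof (rule mfunc.equality)
  show "FOb F = FOb G"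
    using assms(1-3) by (intro extensionalityI[of _ "Obj C"]) (auto simp: mfunc_extensional_def)
  show "FMor F = FMor G"
    using assms(1,2,4) by (intro extensionalityI[of _ "Mor C"]) (auto simp: mfunc_extensional_def)
  show "F2 F = F2 G"
    using assms(1,2,5)
    by (intro extensionalityI[of _ "Obj C \<times> Obj C"]) (auto simp: mfunc_extensional_def)
qed (use assms in simp_all)

lemma mfunc_extensional_id [simp]: "mfunc_extensional C (mfunc_id C)"
  by (simp add: mfunc_extensional_def mfunc_id_def)

lemma mfunc_extensional_comp [simp]: "mfunc_extensional C (mfunc_comp C E G F)"
  by (simp add: mfunc_extensional_def mfunc_comp_def)

lemma monoidal_functor_id:
  assumes "monoidal_category C"
  shows "monoidal_functor C C (mfunc_id C)"
proof -
  interpret C: monoidal_category C by fact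
  show ?thesis
    by (intro monoidal_functorI cat_functorI assms C.category_axioms) (simp_all add: mfunc_id_def)
qed

text \<open>Each coherence law of the composite is the image under \<open>G\<close> of the law for
  \<open>F\<close>, pasted to the law for \<open>G\<close> at the objects \<open>FOb F x\<close>.
  Naturality of \<open>F2 G\<close> at the structure maps of \<open>F\<close> makes the two diagrams
  fit together.\<close>

lemma monoidal_functor_comp:
  fixes F :: "('o, 'm, 'p, 'n) mfunc" and G :: "('p, 'n, 'q, 'l) mfunc"
  assumes "monoidal_functor C D F" "monoidal_functor D E G"
  shows "monoidal_functor C E (mfunc_comp C E G F)"
proof -
  interpret F: monoidal_functor C D F by fact
  interpret G: monoidal_functor D E G by fact
  let ?H = "mfunc_comp C E G F"
  let ?I = "\<lambda>x. Idn E (FOb G (FOb F x))"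
  have H: "cat_functor C E ?H"
    by (intro cat_functorI F.source.category_axioms G.target.category_axioms)
      (simp_all add: mfunc_comp_def)
  show ?thesis
  proof (intro monoidal_functorI F.source.monoidal_category_axioms G.target.monoidal_category_axioms H)
    fix f g assume [simp]: "f \<in> Mor C" "g \<in> Mor C"
    let ?k = "F2 F (Dom C f, Dom C g)" and ?l = "F2 F (Cod C f, Cod C g)"
    have "(FMor G ?l \<cdot>\<^bsub>E\<^esub> F2 G (FOb F (Cod C f), FOb F (Cod C g))) \<cdot>\<^bsub>E\<^esub>
          (FMor G (FMor F f) \<boxtimes>\<^bsub>E\<^esub> FMor G (FMor F g))
        = FMor G (?l \<cdot>\<^bsub>D\<^esub> (FMor F f \<boxtimes>\<^bsub>D\<^esub> FMor F g)) \<cdot>\<^bsub>E\<^esub> F2 G (FOb F (Dom C f), FOb F (Dom C g))"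
      using G.F2_natural[of "FMor F f" "FMor F g"] by simp
    also have "\<dots> = FMor G (FMor F (f \<boxtimes>\<^bsub>C\<^esub> g) \<cdot>\<^bsub>D\<^esub> ?k) \<cdot>\<^bsub>E\<^esub> F2 G (FOb F (Dom C f), FOb F (Dom C g))"
      by (simp only: F.F2_natural \<open>f \<in> Mor C\<close> \<open>g \<in> Mor C\<close>)
    finally show "F2 ?H (Cod C f, Cod C g) \<cdot>\<^bsub>E\<^esub> (FMor ?H f \<boxtimes>\<^bsub>E\<^esub> FMor ?H g)
        = FMor ?H (f \<boxtimes>\<^bsub>C\<^esub> g) \<cdot>\<^bsub>E\<^esub> F2 ?H (Dom C f, Dom C g)"
      by (simp add: mfunc_comp_def)
  next
    fix x y z assume [simp]: "x \<in> Obj C" "y \<in> Obj C" "z \<in> Obj C"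
    let ?x = "FOb F x" and ?y = "FOb F y" and ?z = "FOb F z"
    have "FMor G (FMor F (Assoc C x y z)) \<cdot>\<^bsub>E\<^esub> (FMor G (F2 F (x \<otimes>\<^bsub>C\<^esub> y, z)) \<cdot>\<^bsub>E\<^esub> F2 G (FOb F (x \<otimes>\<^bsub>C\<^esub> y), ?z)) \<cdot>\<^bsub>E\<^esub>
          ((FMor G (F2 F (x, y)) \<cdot>\<^bsub>E\<^esub> F2 G (?x, ?y)) \<boxtimes>\<^bsub>E\<^esub> ?I z)
        = FMor G (FMor F (Assoc C x y z)) \<cdot>\<^bsub>E\<^esub> (FMor G (F2 F (x \<otimes>\<^bsub>C\<^esub> y, z)) \<cdot>\<^bsub>E\<^esub>
          ((F2 G (FOb F (x \<otimes>\<^bsub>C\<^esub> y), ?z) \<cdot>\<^bsub>E\<^esub> (FMor G (F2 F (x, y)) \<boxtimes>\<^bsub>E\<^esub> ?I z)) \<cdot>\<^bsub>E\<^esub> (F2 G (?x, ?y) \<boxtimes>\<^bsub>E\<^esub> ?I z)))"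
      by (simp add: G.target.whisker_right_Comp)
    \<comment> \<open>Naturality gathers all images under \<open>G\<close> at the front, where they
      form the image of the left side of \<open>F_assoc\<close> for \<open>F\<close>.\<close>
    also have "F2 G (FOb F (x \<otimes>\<^bsub>C\<^esub> y), ?z) \<cdot>\<^bsub>E\<^esub> (FMor G (F2 F (x, y)) \<boxtimes>\<^bsub>E\<^esub> ?I z)
        = FMor G (F2 F (x, y) \<boxtimes>\<^bsub>D\<^esub> Idn D ?z) \<cdot>\<^bsub>E\<^esub> F2 G (?x \<otimes>\<^bsub>D\<^esub> ?y, ?z)"
      using G.F2_natural[of "F2 F (x, y)" "Idn D ?z"] by simp
    also have "FMor G (FMor F (Assoc C x y z)) \<cdot>\<^bsub>E\<^esub> (FMor G (F2 F (x \<otimes>\<^bsub>C\<^esub> y, z)) \<cdot>\<^bsub>E\<^esub>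
          ((FMor G (F2 F (x, y) \<boxtimes>\<^bsub>D\<^esub> Idn D ?z) \<cdot>\<^bsub>E\<^esub> F2 G (?x \<otimes>\<^bsub>D\<^esub> ?y, ?z)) \<cdot>\<^bsub>E\<^esub> (F2 G (?x, ?y) \<boxtimes>\<^bsub>E\<^esub> ?I z)))
        = FMor G (FMor F (Assoc C x y z) \<cdot>\<^bsub>D\<^esub> F2 F (x \<otimes>\<^bsub>C\<^esub> y, z) \<cdot>\<^bsub>D\<^esub> (F2 F (x, y) \<boxtimes>\<^bsub>D\<^esub> Idn D ?z)) \<cdot>\<^bsub>E\<^esub>
          (F2 G (?x \<otimes>\<^bsub>D\<^esub> ?y, ?z) \<cdot>\<^bsub>E\<^esub> (F2 G (?x, ?y) \<boxtimes>\<^bsub>E\<^esub> ?I z))"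
      by simp
    also have "\<dots> = FMor G (F2 F (x, y \<otimes>\<^bsub>C\<^esub> z) \<cdot>\<^bsub>D\<^esub> (Idn D ?x \<boxtimes>\<^bsub>D\<^esub> F2 F (y, z)) \<cdot>\<^bsub>D\<^esub> Assoc D ?x ?y ?z) \<cdot>\<^bsub>E\<^esub>
          (F2 G (?x \<otimes>\<^bsub>D\<^esub> ?y, ?z) \<cdot>\<^bsub>E\<^esub> (F2 G (?x, ?y) \<boxtimes>\<^bsub>E\<^esub> ?I z))"
      by (subst F.F_assoc) simp_all
    also have "\<dots> = FMor G (F2 F (x, y \<otimes>\<^bsub>C\<^esub> z)) \<cdot>\<^bsub>E\<^esub> (FMor G (Idn D ?x \<boxtimes>\<^bsub>D\<^esub> F2 F (y, z)) \<cdot>\<^bsub>E\<^esub>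
          (FMor G (Assoc D ?x ?y ?z) \<cdot>\<^bsub>E\<^esub> F2 G (?x \<otimes>\<^bsub>D\<^esub> ?y, ?z) \<cdot>\<^bsub>E\<^esub> (F2 G (?x, ?y) \<boxtimes>\<^bsub>E\<^esub> ?I z)))"
      by simp
    also have "\<dots> = FMor G (F2 F (x, y \<otimes>\<^bsub>C\<^esub> z)) \<cdot>\<^bsub>E\<^esub> ((FMor G (Idn D ?x \<boxtimes>\<^bsub>D\<^esub> F2 F (y, z)) \<cdot>\<^bsub>E\<^esub>
          F2 G (?x, ?y \<otimes>\<^bsub>D\<^esub> ?z)) \<cdot>\<^bsub>E\<^esub> ((?I x \<boxtimes>\<^bsub>E\<^esub> F2 G (?y, ?z)) \<cdot>\<^bsub>E\<^esub>
          Assoc E (FOb G ?x) (FOb G ?y) (FOb G ?z)))"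
      by (subst G.F_assoc) simp_all
    \<comment> \<open>After both associativity laws, naturality is used the other way to restore the
      alternation of \<open>FMor G (F2 F _)\<close> and \<open>F2 G\<close> in the
      composite.\<close>
    also have "FMor G (Idn D ?x \<boxtimes>\<^bsub>D\<^esub> F2 F (y, z)) \<cdot>\<^bsub>E\<^esub> F2 G (?x, ?y \<otimes>\<^bsub>D\<^esub> ?z)
        = F2 G (?x, FOb F (y \<otimes>\<^bsub>C\<^esub> z)) \<cdot>\<^bsub>E\<^esub> (?I x \<boxtimes>\<^bsub>E\<^esub> FMor G (F2 F (y, z)))"
      using G.F2_natural[of "Idn D ?x" "F2 F (y, z)"] by simp
    also have "FMor G (F2 F (x, y \<otimes>\<^bsub>C\<^esub> z)) \<cdot>\<^bsub>E\<^esub> ((F2 G (?x, FOb F (y \<otimes>\<^bsub>C\<^esub> z)) \<cdot>\<^bsub>E\<^esub>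
          (?I x \<boxtimes>\<^bsub>E\<^esub> FMor G (F2 F (y, z)))) \<cdot>\<^bsub>E\<^esub> ((?I x \<boxtimes>\<^bsub>E\<^esub> F2 G (?y, ?z)) \<cdot>\<^bsub>E\<^esub>
          Assoc E (FOb G ?x) (FOb G ?y) (FOb G ?z)))
        = (FMor G (F2 F (x, y \<otimes>\<^bsub>C\<^esub> z)) \<cdot>\<^bsub>E\<^esub> F2 G (?x, FOb F (y \<otimes>\<^bsub>C\<^esub> z))) \<cdot>\<^bsub>E\<^esub>
          (?I x \<boxtimes>\<^bsub>E\<^esub> (FMor G (F2 F (y, z)) \<cdot>\<^bsub>E\<^esub> F2 G (?y, ?z))) \<cdot>\<^bsub>E\<^esub>
          Assoc E (FOb G ?x) (FOb G ?y) (FOb G ?z)"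
      by (simp add: G.target.whisker_left_Comp)
    finally show "FMor ?H (Assoc C x y z) \<cdot>\<^bsub>E\<^esub> F2 ?H (x \<otimes>\<^bsub>C\<^esub> y, z) \<cdot>\<^bsub>E\<^esub> (F2 ?H (x, y) \<boxtimes>\<^bsub>E\<^esub> Idn E (FOb ?H z))
        = F2 ?H (x, y \<otimes>\<^bsub>C\<^esub> z) \<cdot>\<^bsub>E\<^esub> (Idn E (FOb ?H x) \<boxtimes>\<^bsub>E\<^esub> F2 ?H (y, z))
          \<cdot>\<^bsub>E\<^esub> Assoc E (FOb ?H x) (FOb ?H y) (FOb ?H z)"
      by (simp add: mfunc_comp_def)
  next
    \<comment> \<open>For the unit laws \<open>F0\<close> takes the place of the inner
      \<open>F2\<close>, and a single naturality square suffices for each.\<close>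
    fix x assume [simp]: "x \<in> Obj C"
    let ?x = "FOb F x"
    have "FMor G (FMor F (LUnit C x)) \<cdot>\<^bsub>E\<^esub> (FMor G (F2 F (\<one>\<^bsub>C\<^esub>, x)) \<cdot>\<^bsub>E\<^esub> F2 G (FOb F \<one>\<^bsub>C\<^esub>, ?x)) \<cdot>\<^bsub>E\<^esub>
          ((FMor G (F0 F) \<cdot>\<^bsub>E\<^esub> F0 G) \<boxtimes>\<^bsub>E\<^esub> ?I x)
        = FMor G (FMor F (LUnit C x)) \<cdot>\<^bsub>E\<^esub> (FMor G (F2 F (\<one>\<^bsub>C\<^esub>, x)) \<cdot>\<^bsub>E\<^esub>
          ((F2 G (FOb F \<one>\<^bsub>C\<^esub>, ?x) \<cdot>\<^bsub>E\<^esub> (FMor G (F0 F) \<boxtimes>\<^bsub>E\<^esub> ?I x)) \<cdot>\<^bsub>E\<^esub> (F0 G \<boxtimes>\<^bsub>E\<^esub> ?I x)))"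
      by (simp add: G.target.whisker_right_Comp)
    also have "F2 G (FOb F \<one>\<^bsub>C\<^esub>, ?x) \<cdot>\<^bsub>E\<^esub> (FMor G (F0 F) \<boxtimes>\<^bsub>E\<^esub> ?I x)
        = FMor G (F0 F \<boxtimes>\<^bsub>D\<^esub> Idn D ?x) \<cdot>\<^bsub>E\<^esub> F2 G (\<one>\<^bsub>D\<^esub>, ?x)"
      using G.F2_natural[of "F0 F" "Idn D ?x"] by simp
    also have "FMor G (FMor F (LUnit C x)) \<cdot>\<^bsub>E\<^esub> (FMor G (F2 F (\<one>\<^bsub>C\<^esub>, x)) \<cdot>\<^bsub>E\<^esub>
          ((FMor G (F0 F \<boxtimes>\<^bsub>D\<^esub> Idn D ?x) \<cdot>\<^bsub>E\<^esub> F2 G (\<one>\<^bsub>D\<^esub>, ?x)) \<cdot>\<^bsub>E\<^esub> (F0 G \<boxtimes>\<^bsub>E\<^esub> ?I x)))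
        = FMor G (FMor F (LUnit C x) \<cdot>\<^bsub>D\<^esub> F2 F (\<one>\<^bsub>C\<^esub>, x) \<cdot>\<^bsub>D\<^esub> (F0 F \<boxtimes>\<^bsub>D\<^esub> Idn D ?x)) \<cdot>\<^bsub>E\<^esub>
          F2 G (\<one>\<^bsub>D\<^esub>, ?x) \<cdot>\<^bsub>E\<^esub> (F0 G \<boxtimes>\<^bsub>E\<^esub> ?I x)"
      by simp
    also have "\<dots> = LUnit E (FOb G ?x)"
      by (simp only: F.F_lunit \<open>x \<in> Obj C\<close> F.FOb_closed G.F_lunit)
    finally show "FMor ?H (LUnit C x) \<cdot>\<^bsub>E\<^esub> F2 ?H (\<one>\<^bsub>C\<^esub>, x) \<cdot>\<^bsub>E\<^esub> (F0 ?H \<boxtimes>\<^bsub>E\<^esub> Idn E (FOb ?H x))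
        = LUnit E (FOb ?H x)"
      by (simp add: mfunc_comp_def)
    have "FMor G (FMor F (RUnit C x)) \<cdot>\<^bsub>E\<^esub> (FMor G (F2 F (x, \<one>\<^bsub>C\<^esub>)) \<cdot>\<^bsub>E\<^esub> F2 G (?x, FOb F \<one>\<^bsub>C\<^esub>)) \<cdot>\<^bsub>E\<^esub>
          (?I x \<boxtimes>\<^bsub>E\<^esub> (FMor G (F0 F) \<cdot>\<^bsub>E\<^esub> F0 G))
        = FMor G (FMor F (RUnit C x)) \<cdot>\<^bsub>E\<^esub> (FMor G (F2 F (x, \<one>\<^bsub>C\<^esub>)) \<cdot>\<^bsub>E\<^esub>
          ((F2 G (?x, FOb F \<one>\<^bsub>C\<^esub>) \<cdot>\<^bsub>E\<^esub> (?I x \<boxtimes>\<^bsub>E\<^esub> FMor G (F0 F))) \<cdot>\<^bsub>E\<^esub> (?I x \<boxtimes>\<^bsub>E\<^esub> F0 G)))"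
      by (simp add: G.target.whisker_left_Comp)
    also have "F2 G (?x, FOb F \<one>\<^bsub>C\<^esub>) \<cdot>\<^bsub>E\<^esub> (?I x \<boxtimes>\<^bsub>E\<^esub> FMor G (F0 F))
        = FMor G (Idn D ?x \<boxtimes>\<^bsub>D\<^esub> F0 F) \<cdot>\<^bsub>E\<^esub> F2 G (?x, \<one>\<^bsub>D\<^esub>)"
      using G.F2_natural[of "Idn D ?x" "F0 F"] by simp
    also have "FMor G (FMor F (RUnit C x)) \<cdot>\<^bsub>E\<^esub> (FMor G (F2 F (x, \<one>\<^bsub>C\<^esub>)) \<cdot>\<^bsub>E\<^esub>
          ((FMor G (Idn D ?x \<boxtimes>\<^bsub>D\<^esub> F0 F) \<cdot>\<^bsub>E\<^esub> F2 G (?x, \<one>\<^bsub>D\<^esub>)) \<cdot>\<^bsub>E\<^esub> (?I x \<boxtimes>\<^bsub>E\<^esub> F0 G)))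
        = FMor G (FMor F (RUnit C x) \<cdot>\<^bsub>D\<^esub> F2 F (x, \<one>\<^bsub>C\<^esub>) \<cdot>\<^bsub>D\<^esub> (Idn D ?x \<boxtimes>\<^bsub>D\<^esub> F0 F)) \<cdot>\<^bsub>E\<^esub>
          F2 G (?x, \<one>\<^bsub>D\<^esub>) \<cdot>\<^bsub>E\<^esub> (?I x \<boxtimes>\<^bsub>E\<^esub> F0 G)"
      by simp
    also have "\<dots> = RUnit E (FOb G ?x)"
      by (simp only: F.F_runit \<open>x \<in> Obj C\<close> F.FOb_closed G.F_runit)
    finally show "FMor ?H (RUnit C x) \<cdot>\<^bsub>E\<^esub> F2 ?H (x, \<one>\<^bsub>C\<^esub>) \<cdot>\<^bsub>E\<^esub> (Idn E (FOb ?H x) \<boxtimes>\<^bsub>E\<^esub> F0 ?H)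
        = RUnit E (FOb ?H x)"
      by (simp add: mfunc_comp_def)
  qed (simp_all add: mfunc_comp_def)
qed

section \<open>Identities and the two compositions of monoidal transformations\<close>

lemma monoidal_transformation_id:
  assumes "monoidal_functor C D F"
  shows "monoidal_transformation C D F F (\<lambda>x \<in> Obj C. Idn D (FOb F x))"
proof -
  interpret F: monoidal_functor C D F by fact
  show ?thesis
    by (intro monoidal_transformationI assms) simp_all
qed

lemma monoidal_transformation_vcomp:
  assumes "monoidal_transformation C D F G \<sigma>" "monoidal_transformation C D G H \<tau>"
  shows "monoidal_transformation C D F H (\<lambda>x \<in> Obj C. \<tau> x \<cdot>\<^bsub>D\<^esub> \<sigma> x)"
proof -
  interpret \<sigma>: monoidal_transformation C D F G \<sigma> by fact
  interpret \<tau>: monoidal_transformation C D G H \<tau> by fact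
  show ?thesis
  proof (intro monoidal_transformationI \<sigma>.F.monoidal_functor_axioms \<tau>.G.monoidal_functor_axioms)
    fix f assume [simp]: "f \<in> Mor C"
    have "(\<tau> (Cod C f) \<cdot>\<^bsub>D\<^esub> \<sigma> (Cod C f)) \<cdot>\<^bsub>D\<^esub> FMor F f = \<tau> (Cod C f) \<cdot>\<^bsub>D\<^esub> (FMor G f \<cdot>\<^bsub>D\<^esub> \<sigma> (Dom C f))"
      using \<sigma>.naturality'[of f] by simp
    also have "\<dots> = FMor H f \<cdot>\<^bsub>D\<^esub> (\<tau> (Dom C f) \<cdot>\<^bsub>D\<^esub> \<sigma> (Dom C f))"
      using \<tau>.naturality'[of f] by (intro \<sigma>.F.target.Comp_eq_extend) simp_all
    finally show "(\<lambda>x \<in> Obj C. \<tau> x \<cdot>\<^bsub>D\<^esub> \<sigma> x) (Cod C f) \<cdot>\<^bsub>D\<^esub> FMor F f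
        = FMor H f \<cdot>\<^bsub>D\<^esub> (\<lambda>x \<in> Obj C. \<tau> x \<cdot>\<^bsub>D\<^esub> \<sigma> x) (Dom C f)"
      by simp
  next
    fix x y assume [simp]: "x \<in> Obj C" "y \<in> Obj C"
    have "F2 H (x, y) \<cdot>\<^bsub>D\<^esub> ((\<tau> x \<cdot>\<^bsub>D\<^esub> \<sigma> x) \<boxtimes>\<^bsub>D\<^esub> (\<tau> y \<cdot>\<^bsub>D\<^esub> \<sigma> y))
        = F2 H (x, y) \<cdot>\<^bsub>D\<^esub> ((\<tau> x \<boxtimes>\<^bsub>D\<^esub> \<tau> y) \<cdot>\<^bsub>D\<^esub> (\<sigma> x \<boxtimes>\<^bsub>D\<^esub> \<sigma> y))"
      by (simp add: \<sigma>.F.target.interchange)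
    also have "\<dots> = \<tau> (x \<otimes>\<^bsub>C\<^esub> y) \<cdot>\<^bsub>D\<^esub> (F2 G (x, y) \<cdot>\<^bsub>D\<^esub> (\<sigma> x \<boxtimes>\<^bsub>D\<^esub> \<sigma> y))"
      using \<tau>.tensor_compat[of x y] by (intro \<sigma>.F.target.Comp_eq_extend) simp_all
    also have "\<dots> = (\<tau> (x \<otimes>\<^bsub>C\<^esub> y) \<cdot>\<^bsub>D\<^esub> \<sigma> (x \<otimes>\<^bsub>C\<^esub> y)) \<cdot>\<^bsub>D\<^esub> F2 F (x, y)"
      using \<sigma>.tensor_compat[of x y] by simp
    finally show "F2 H (x, y) \<cdot>\<^bsub>D\<^esub> ((\<lambda>x \<in> Obj C. \<tau> x \<cdot>\<^bsub>D\<^esub> \<sigma> x) x \<boxtimes>\<^bsub>D\<^esub> (\<lambda>x \<in> Obj C. \<tau> x \<cdot>\<^bsub>D\<^esub> \<sigma> x) y)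
        = (\<lambda>x \<in> Obj C. \<tau> x \<cdot>\<^bsub>D\<^esub> \<sigma> x) (x \<otimes>\<^bsub>C\<^esub> y) \<cdot>\<^bsub>D\<^esub> F2 F (x, y)"
      by simp
  next
    show "(\<lambda>x \<in> Obj C. \<tau> x \<cdot>\<^bsub>D\<^esub> \<sigma> x) \<one>\<^bsub>C\<^esub> \<cdot>\<^bsub>D\<^esub> F0 F = F0 H"
      using \<sigma>.unit_compat \<tau>.unit_compat by simp
  qed simp_all
qed

text \<open>The components apply \<open>H\<close> to \<open>\<sigma>\<close> and then
  \<open>\<tau>\<close> at the values of \<open>G\<close>. Naturality of \<open>\<tau>\<close> at
  the structure maps \<open>F2 G (x, y)\<close> and \<open>F0 G\<close> moves them from
  \<open>K\<close> to \<open>H\<close>, where the laws of \<open>\<sigma>\<close> apply.\<close>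

lemma monoidal_transformation_hcomp:
  fixes F G :: "('o, 'm, 'p, 'n) mfunc" and H K :: "('p, 'n, 'q, 'l) mfunc"
  assumes "monoidal_transformation C D F G \<sigma>" "monoidal_transformation D E H K \<tau>"
  shows "monoidal_transformation C E (mfunc_comp C E H F) (mfunc_comp C E K G)
    (\<lambda>x \<in> Obj C. \<tau> (FOb G x) \<cdot>\<^bsub>E\<^esub> FMor H (\<sigma> x))"
    (is "monoidal_transformation C E ?HF ?KG ?\<theta>")
proof -
  interpret \<sigma>: monoidal_transformation C D F G \<sigma> by fact
  interpret \<tau>: monoidal_transformation D E H K \<tau> by fact
  show ?thesis
  proof (intro monoidal_transformationI monoidal_functor_comp)
    fix f assume [simp]: "f \<in> Mor C"
    have "(\<tau> (FOb G (Cod C f)) \<cdot>\<^bsub>E\<^esub> FMor H (\<sigma> (Cod C f))) \<cdot>\<^bsub>E\<^esub> FMor H (FMor F f)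
        = \<tau> (FOb G (Cod C f)) \<cdot>\<^bsub>E\<^esub> FMor H (\<sigma> (Cod C f) \<cdot>\<^bsub>D\<^esub> FMor F f)"
      by simp
    also have "\<dots> = \<tau> (FOb G (Cod C f)) \<cdot>\<^bsub>E\<^esub> (FMor H (FMor G f) \<cdot>\<^bsub>E\<^esub> FMor H (\<sigma> (Dom C f)))"
      unfolding \<sigma>.naturality'[OF \<open>f \<in> Mor C\<close>] by simp
    also have "\<dots> = FMor K (FMor G f) \<cdot>\<^bsub>E\<^esub> (\<tau> (FOb G (Dom C f)) \<cdot>\<^bsub>E\<^esub> FMor H (\<sigma> (Dom C f)))"
      using \<tau>.naturality'[of "FMor G f"] by (intro \<tau>.F.target.Comp_eq_extend) simp_all
    finally show "?\<theta> (Cod C f) \<cdot>\<^bsub>E\<^esub> FMor ?HF f = FMor ?KG f \<cdot>\<^bsub>E\<^esub> ?\<theta> (Dom C f)"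
      by (simp add: mfunc_comp_def)
  next
    fix x y assume [simp]: "x \<in> Obj C" "y \<in> Obj C"
    let ?x = "FOb G x" and ?y = "FOb G y" and ?xy = "FOb G (x \<otimes>\<^bsub>C\<^esub> y)"
    have "(FMor K (F2 G (x, y)) \<cdot>\<^bsub>E\<^esub> F2 K (?x, ?y)) \<cdot>\<^bsub>E\<^esub>
          ((\<tau> ?x \<cdot>\<^bsub>E\<^esub> FMor H (\<sigma> x)) \<boxtimes>\<^bsub>E\<^esub> (\<tau> ?y \<cdot>\<^bsub>E\<^esub> FMor H (\<sigma> y)))
        = FMor K (F2 G (x, y)) \<cdot>\<^bsub>E\<^esub> ((F2 K (?x, ?y) \<cdot>\<^bsub>E\<^esub> (\<tau> ?x \<boxtimes>\<^bsub>E\<^esub> \<tau> ?y)) \<cdot>\<^bsub>E\<^esub> (FMor H (\<sigma> x) \<boxtimes>\<^bsub>E\<^esub> FMor H (\<sigma> y)))"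
      by (simp add: \<tau>.F.target.interchange)
    also have "\<dots> = (FMor K (F2 G (x, y)) \<cdot>\<^bsub>E\<^esub> \<tau> (?x \<otimes>\<^bsub>D\<^esub> ?y)) \<cdot>\<^bsub>E\<^esub> (F2 H (?x, ?y) \<cdot>\<^bsub>E\<^esub> (FMor H (\<sigma> x) \<boxtimes>\<^bsub>E\<^esub> FMor H (\<sigma> y)))"
      using \<tau>.tensor_compat[of ?x ?y] by simp
    also have "F2 H (?x, ?y) \<cdot>\<^bsub>E\<^esub> (FMor H (\<sigma> x) \<boxtimes>\<^bsub>E\<^esub> FMor H (\<sigma> y))
        = FMor H (\<sigma> x \<boxtimes>\<^bsub>D\<^esub> \<sigma> y) \<cdot>\<^bsub>E\<^esub> F2 H (FOb F x, FOb F y)"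
      using \<tau>.F.F2_natural[of "\<sigma> x" "\<sigma> y"] by simp
    also have "FMor K (F2 G (x, y)) \<cdot>\<^bsub>E\<^esub> \<tau> (?x \<otimes>\<^bsub>D\<^esub> ?y) = \<tau> ?xy \<cdot>\<^bsub>E\<^esub> FMor H (F2 G (x, y))"
      using \<tau>.naturality'[of "F2 G (x, y)"] by simp
    also have "(\<tau> ?xy \<cdot>\<^bsub>E\<^esub> FMor H (F2 G (x, y))) \<cdot>\<^bsub>E\<^esub> (FMor H (\<sigma> x \<boxtimes>\<^bsub>D\<^esub> \<sigma> y) \<cdot>\<^bsub>E\<^esub> F2 H (FOb F x, FOb F y))
        = \<tau> ?xy \<cdot>\<^bsub>E\<^esub> (FMor H (F2 G (x, y) \<cdot>\<^bsub>D\<^esub> (\<sigma> x \<boxtimes>\<^bsub>D\<^esub> \<sigma> y)) \<cdot>\<^bsub>E\<^esub> F2 H (FOb F x, FOb F y))"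
      by simp
    also have "\<dots> = (\<tau> ?xy \<cdot>\<^bsub>E\<^esub> FMor H (\<sigma> (x \<otimes>\<^bsub>C\<^esub> y))) \<cdot>\<^bsub>E\<^esub> (FMor H (F2 F (x, y)) \<cdot>\<^bsub>E\<^esub> F2 H (FOb F x, FOb F y))"
      by (subst \<sigma>.tensor_compat) simp_all
    finally show "F2 ?KG (x, y) \<cdot>\<^bsub>E\<^esub> (?\<theta> x \<boxtimes>\<^bsub>E\<^esub> ?\<theta> y) = ?\<theta> (x \<otimes>\<^bsub>C\<^esub> y) \<cdot>\<^bsub>E\<^esub> F2 ?HF (x, y)"
      by (simp add: mfunc_comp_def)
  next
    have "(\<tau> (FOb G \<one>\<^bsub>C\<^esub>) \<cdot>\<^bsub>E\<^esub> FMor H (\<sigma> \<one>\<^bsub>C\<^esub>)) \<cdot>\<^bsub>E\<^esub> (FMor H (F0 F) \<cdot>\<^bsub>E\<^esub> F0 H)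
        = \<tau> (FOb G \<one>\<^bsub>C\<^esub>) \<cdot>\<^bsub>E\<^esub> (FMor H (\<sigma> \<one>\<^bsub>C\<^esub> \<cdot>\<^bsub>D\<^esub> F0 F) \<cdot>\<^bsub>E\<^esub> F0 H)"
      by simp
    also have "\<dots> = FMor K (F0 G) \<cdot>\<^bsub>E\<^esub> (\<tau> \<one>\<^bsub>D\<^esub> \<cdot>\<^bsub>E\<^esub> F0 H)"
      unfolding \<sigma>.unit_compat using \<tau>.naturality'[of "F0 G"]
      by (intro \<tau>.F.target.Comp_eq_extend) simp_all
    finally show "?\<theta> \<one>\<^bsub>C\<^esub> \<cdot>\<^bsub>E\<^esub> F0 ?HF = F0 ?KG"
      by (simp add: mfunc_comp_def \<tau>.unit_compat)
  qed (use \<sigma>.F.monoidal_functor_axioms \<sigma>.G.monoidal_functor_axioms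
      \<tau>.F.monoidal_functor_axioms \<tau>.G.monoidal_functor_axioms in \<open>auto simp: mfunc_comp_def\<close>)
qed

section \<open>The 2-category of monoidal categories\<close>

lemma mon_hom_cat_simps [simp]:
  "F \<in> Obj (mon_hom_cat C D) \<longleftrightarrow> monoidal_functor C D F \<and> mfunc_extensional C F"
  "\<theta> \<in> Mor (mon_hom_cat C D) \<longleftrightarrow> mfunc_extensional C (Src \<theta>) \<and> mfunc_extensional C (Tgt \<theta>) \<and>
    monoidal_transformation C D (Src \<theta>) (Tgt \<theta>) (Cmp \<theta>) \<and> Cmp \<theta> \<in> extensional (Obj C)"
  "Dom (mon_hom_cat C D) = Src"
  "Cod (mon_hom_cat C D) = Tgt"
  "Idn (mon_hom_cat C D) F = \<lparr>Src = F, Tgt = F, Cmp = (\<lambda>x \<in> Obj C. Idn D (FOb F x))\<rparr>"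
  "Comp (mon_hom_cat C D) \<tau> \<sigma> =
    \<lparr>Src = Src \<sigma>, Tgt = Tgt \<tau>, Cmp = (\<lambda>x \<in> Obj C. Cmp \<tau> x \<cdot>\<^bsub>D\<^esub> Cmp \<sigma> x)\<rparr>"
  by (auto simp: mon_hom_cat_def)

lemma mtrans_eqI:
  fixes \<sigma> \<tau> :: "('o, 'm, 'p, 'n) mtrans"
  assumes "Src \<sigma> = Src \<tau>" "Tgt \<sigma> = Tgt \<tau>"
    "Cmp \<sigma> \<in> extensional A" "Cmp \<tau> \<in> extensional A" "\<And>x. x \<in> A \<Longrightarrow> Cmp \<sigma> x = Cmp \<tau> x"
  shows "\<sigma> = \<tau>"
  using assms by (intro mtrans.equality extensionalityI[of _ A]) simp_all

lemma mtrans_hcomp_simps [simp]: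
  "Src (mtrans_hcomp C E \<tau> \<sigma>) = mfunc_comp C E (Src \<tau>) (Src \<sigma>)"
  "Tgt (mtrans_hcomp C E \<tau> \<sigma>) = mfunc_comp C E (Tgt \<tau>) (Tgt \<sigma>)"
  "Cmp (mtrans_hcomp C E \<tau> \<sigma>) = (\<lambda>x \<in> Obj C. Cmp \<tau> (FOb (Tgt \<sigma>) x) \<cdot>\<^bsub>E\<^esub> FMor (Src \<tau>) (Cmp \<sigma> x))"
  by (simp_all add: mtrans_hcomp_def)

lemma mfunc_comp_simps [simp]:
  "x \<in> Obj C \<Longrightarrow> FOb (mfunc_comp C E G F) x = FOb G (FOb F x)"
  "f \<in> Mor C \<Longrightarrow> FMor (mfunc_comp C E G F) f = FMor G (FMor F f)"
  "x \<in> Obj C \<Longrightarrow> y \<in> Obj C \<Longrightarrow>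
    F2 (mfunc_comp C E G F) (x, y) = FMor G (F2 F (x, y)) \<cdot>\<^bsub>E\<^esub> F2 G (FOb F x, FOb F y)"
  "F0 (mfunc_comp C E G F) = FMor G (F0 F) \<cdot>\<^bsub>E\<^esub> F0 G"
  by (simp_all add: mfunc_comp_def)

lemma mfunc_id_simps [simp]:
  "x \<in> Obj C \<Longrightarrow> FOb (mfunc_id C) x = x"
  "f \<in> Mor C \<Longrightarrow> FMor (mfunc_id C) f = f"
  "x \<in> Obj C \<Longrightarrow> y \<in> Obj C \<Longrightarrow> F2 (mfunc_id C) (x, y) = Idn C (x \<otimes>\<^bsub>C\<^esub> y)"
  "F0 (mfunc_id C) = Idn C \<one>\<^bsub>C\<^esub>"
  by (simp_all add: mfunc_id_def)

text \<open>Being monoidal is part of \<open>monoidal_functor\<close>, so every 1-cell and 2-cell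
  brings the facts about \<open>C\<close> and \<open>D\<close> with it; if one of them is not
  monoidal, the hom category is empty.\<close>

lemma mon_hom_category: "category (mon_hom_cat C D)"
proof (unfold_locales, unfold Hom_def)
  fix f assume "f \<in> Mor (mon_hom_cat C D)"
  then show "Dom (mon_hom_cat C D) f \<in> Obj (mon_hom_cat C D)"
    "Cod (mon_hom_cat C D) f \<in> Obj (mon_hom_cat C D)"
    by (simp_all add: monoidal_transformation_def)
next
  fix F assume "F \<in> Obj (mon_hom_cat C D)"
  then show "Idn (mon_hom_cat C D) F \<in> {f \<in> Mor (mon_hom_cat C D).
      Dom (mon_hom_cat C D) f = F \<and> Cod (mon_hom_cat C D) f = F}"
    by (simp add: monoidal_transformation_id)
next
  fix \<sigma> \<tau> F G H
  assume "\<sigma> \<in> {f \<in> Mor (mon_hom_cat C D). Dom (mon_hom_cat C D) f = F \<and> Cod (mon_hom_cat C D) f = G}"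
    "\<tau> \<in> {f \<in> Mor (mon_hom_cat C D). Dom (mon_hom_cat C D) f = G \<and> Cod (mon_hom_cat C D) f = H}"
  then show "\<tau> \<cdot>\<^bsub>mon_hom_cat C D\<^esub> \<sigma> \<in> {f \<in> Mor (mon_hom_cat C D).
      Dom (mon_hom_cat C D) f = F \<and> Cod (mon_hom_cat C D) f = H}"
    by (auto intro: monoidal_transformation_vcomp)
next
  fix \<sigma> F G
  assume "\<sigma> \<in> {f \<in> Mor (mon_hom_cat C D). Dom (mon_hom_cat C D) f = F \<and> Cod (mon_hom_cat C D) f = G}"
  then have \<sigma>: "monoidal_transformation C D F G (Cmp \<sigma>)" "Cmp \<sigma> \<in> extensional (Obj C)"
      "Src \<sigma> = F" "Tgt \<sigma> = G"
    by auto
  interpret monoidal_transformation C D F G "Cmp \<sigma>" by (rule \<sigma>(1))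
  show "\<sigma> \<cdot>\<^bsub>mon_hom_cat C D\<^esub> Idn (mon_hom_cat C D) F = \<sigma>"
    "Idn (mon_hom_cat C D) G \<cdot>\<^bsub>mon_hom_cat C D\<^esub> \<sigma> = \<sigma>"
    using \<sigma>(2-) by (auto intro: mtrans_eqI[of _ _ "Obj C"])
next
  fix \<rho> \<sigma> \<tau> F G H K
  assume "\<rho> \<in> {f \<in> Mor (mon_hom_cat C D). Dom (mon_hom_cat C D) f = F \<and> Cod (mon_hom_cat C D) f = G}"
    "\<sigma> \<in> {f \<in> Mor (mon_hom_cat C D). Dom (mon_hom_cat C D) f = G \<and> Cod (mon_hom_cat C D) f = H}"
    "\<tau> \<in> {f \<in> Mor (mon_hom_cat C D). Dom (mon_hom_cat C D) f = H \<and> Cod (mon_hom_cat C D) f = K}"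
  then have "monoidal_transformation C D F G (Cmp \<rho>)" "monoidal_transformation C D G H (Cmp \<sigma>)"
    "monoidal_transformation C D H K (Cmp \<tau>)"
    by auto
  then interpret \<rho>: monoidal_transformation C D F G "Cmp \<rho>" + \<sigma>: monoidal_transformation C D G H "Cmp \<sigma>"
    + \<tau>: monoidal_transformation C D H K "Cmp \<tau>" .
  show "(\<tau> \<cdot>\<^bsub>mon_hom_cat C D\<^esub> \<sigma>) \<cdot>\<^bsub>mon_hom_cat C D\<^esub> \<rho> = \<tau> \<cdot>\<^bsub>mon_hom_cat C D\<^esub> (\<sigma> \<cdot>\<^bsub>mon_hom_cat C D\<^esub> \<rho>)"
    by (intro mtrans_eqI[of _ _ "Obj C"]) simp_all
qed

text \<open>Associativity is strict because \<open>H\<close> preserves composition, which matches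
  the two structure maps, and because restriction makes the values outside the domain agree.\<close>

lemma mfunc_comp_assoc:
  assumes "monoidal_functor A B F" "monoidal_functor B C G" "monoidal_functor C D H"
  shows "mfunc_comp A D (mfunc_comp B D H G) F = mfunc_comp A D H (mfunc_comp A C G F)"
proof -
  interpret F: monoidal_functor A B F + G: monoidal_functor B C G + H: monoidal_functor C D H
    by (rule assms)+
  show ?thesis by (rule mfunc_eqI[of A]) simp_all
qed

text \<open>\<open>mfunc_comp\<close> restricts its result to \<open>C\<close>, so it returns
  \<open>F\<close> itself thanks to \<open>F\<close> being extensional.\<close>

lemma mfunc_comp_id:
  assumes "monoidal_functor C D F" "mfunc_extensional C F"
  shows "mfunc_comp C D F (mfunc_id C) = F" "mfunc_comp C D (mfunc_id D) F = F"
proof -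
  interpret F: monoidal_functor C D F by fact
  show "mfunc_comp C D F (mfunc_id C) = F" "mfunc_comp C D (mfunc_id D) F = F"
    using assms(2) by (auto intro!: mfunc_eqI[of C])
qed

text \<open>Preservation of composition, the last case, is the middle-four interchange law for
  2-cells.\<close>

lemma hcomp_functor:
  "cat_functor (prod_cat (mon_hom_cat B C) (mon_hom_cat A B)) (mon_hom_cat A C)
    \<lparr>FOb = (\<lambda>(G, F). mfunc_comp A C G F), FMor = (\<lambda>(\<tau>, \<sigma>). mtrans_hcomp A C \<tau> \<sigma>)\<rparr>"
proof (intro cat_functorI prod_category mon_hom_category, goal_cases)
  case (1 GF)
  then show ?case by (auto intro: monoidal_functor_comp)
next
  case (2 \<tau>\<sigma>)
  then show ?case by (auto intro: monoidal_transformation_hcomp)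
next
  case (3 \<tau>\<sigma>)
  then show ?case by auto
next
  case (4 \<tau>\<sigma>)
  then show ?case by auto
next
  case (5 GF)
  then obtain G F where [simp]: "GF = (G, F)" and GF: "monoidal_functor B C G" "monoidal_functor A B F"
    by auto
  interpret F: monoidal_functor A B F + G: monoidal_functor B C G by (rule GF)+
  show ?case by (simp, intro mtrans_eqI[of _ _ "Obj A"]) simp_all
next
  case (6 \<tau>\<sigma> \<tau>\<sigma>')
  obtain \<tau> \<sigma> \<tau>' \<sigma>' where [simp]: "\<tau>\<sigma> = (\<tau>, \<sigma>)" "\<tau>\<sigma>' = (\<tau>', \<sigma>')"
    by (cases \<tau>\<sigma>, cases \<tau>\<sigma>')
  have t: "monoidal_transformation A B (Src \<sigma>) (Tgt \<sigma>) (Cmp \<sigma>)"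
    "monoidal_transformation B C (Src \<tau>) (Tgt \<tau>) (Cmp \<tau>)"
    "monoidal_transformation A B (Tgt \<sigma>) (Tgt \<sigma>') (Cmp \<sigma>')"
    "monoidal_transformation B C (Tgt \<tau>) (Tgt \<tau>') (Cmp \<tau>')"
    and [simp]: "Src \<sigma>' = Tgt \<sigma>" "Src \<tau>' = Tgt \<tau>"
    using 6 by auto
  interpret \<sigma>: monoidal_transformation A B "Src \<sigma>" "Tgt \<sigma>" "Cmp \<sigma>" by (rule t)
  interpret \<tau>: monoidal_transformation B C "Src \<tau>" "Tgt \<tau>" "Cmp \<tau>" by (rule t)
  interpret \<sigma>': monoidal_transformation A B "Tgt \<sigma>" "Tgt \<sigma>'" "Cmp \<sigma>'" by (rule t)
  interpret \<tau>': monoidal_transformation B C "Tgt \<tau>" "Tgt \<tau>'" "Cmp \<tau>'" by (rule t)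
  have "(Cmp \<tau>' (FOb (Tgt \<sigma>') x) \<cdot>\<^bsub>C\<^esub> Cmp \<tau> (FOb (Tgt \<sigma>') x)) \<cdot>\<^bsub>C\<^esub>
      FMor (Src \<tau>) (Cmp \<sigma>' x \<cdot>\<^bsub>B\<^esub> Cmp \<sigma> x)
    = (Cmp \<tau>' (FOb (Tgt \<sigma>') x) \<cdot>\<^bsub>C\<^esub> FMor (Tgt \<tau>) (Cmp \<sigma>' x)) \<cdot>\<^bsub>C\<^esub>
      (Cmp \<tau> (FOb (Tgt \<sigma>) x) \<cdot>\<^bsub>C\<^esub> FMor (Src \<tau>) (Cmp \<sigma> x))"
    if x [simp]: "x \<in> Obj A" for x
  proof -
    \<comment> \<open>The two orders differ only in the middle, where \<open>\<tau>\<close> meets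
      \<open>\<sigma>'\<close>; naturality of \<open>\<tau>\<close> at the component of
      \<open>\<sigma>'\<close> exchanges them.\<close>
    have "Cmp \<tau> (FOb (Tgt \<sigma>') x) \<cdot>\<^bsub>C\<^esub> (FMor (Src \<tau>) (Cmp \<sigma>' x) \<cdot>\<^bsub>C\<^esub> FMor (Src \<tau>) (Cmp \<sigma> x))
        = FMor (Tgt \<tau>) (Cmp \<sigma>' x) \<cdot>\<^bsub>C\<^esub> (Cmp \<tau> (FOb (Tgt \<sigma>) x) \<cdot>\<^bsub>C\<^esub> FMor (Src \<tau>) (Cmp \<sigma> x))"
      using \<tau>.naturality'[of "Cmp \<sigma>' x"] by (intro \<tau>.F.target.Comp_eq_extend) simp_all
    then show ?thesis by simp
  qed
  then show ?case by (simp, intro mtrans_eqI[of _ _ "Obj A"]) simp_all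
qed

lemma mon_two_cat_simps [simp]:
  "Ob (mon_two_cat S) = S"
  "HomCat (mon_two_cat S) = mon_hom_cat"
  "Id1 (mon_two_cat S) = mfunc_id"
  "HComp (mon_two_cat S) A B C =
    \<lparr>FOb = (\<lambda>(G, F). mfunc_comp A C G F), FMor = (\<lambda>(\<tau>, \<sigma>). mtrans_hcomp A C \<tau> \<sigma>)\<rparr>"
  by (simp_all add: mon_two_cat_def)

text \<open>The record scheme is left general so that this covers \<open>W2G\<close> and
  \<open>C2G\<close> alike.\<close>

lemma two_category_mon_two_cat:
  assumes S: "\<And>C. C \<in> S \<Longrightarrow> monoidal_category C"
  shows "two_category (mon_two_cat S)"
proof (intro two_category.intro, simp_all only: mon_two_cat_simps select_convs prod.case, goal_cases)
  case (1 A B)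
  show ?case by (rule mon_hom_category)
next
  case (2 A)
  then show ?case by (simp add: S monoidal_functor_id)
next
  case (3 A B C)
  show ?case by (rule hcomp_functor)
next
  case (4 A B C D f g h)
  then show ?case by (auto intro!: mfunc_comp_assoc)
next
  case (5 A B C D \<rho> \<sigma> \<tau>)
  then have t: "monoidal_transformation A B (Src \<rho>) (Tgt \<rho>) (Cmp \<rho>)"
    "monoidal_transformation B C (Src \<sigma>) (Tgt \<sigma>) (Cmp \<sigma>)"
    "monoidal_transformation C D (Src \<tau>) (Tgt \<tau>) (Cmp \<tau>)"
    by auto
  interpret \<rho>: monoidal_transformation A B "Src \<rho>" "Tgt \<rho>" "Cmp \<rho>" by (rule t)
  interpret \<sigma>: monoidal_transformation B C "Src \<sigma>" "Tgt \<sigma>" "Cmp \<sigma>" by (rule t)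
  interpret \<tau>: monoidal_transformation C D "Src \<tau>" "Tgt \<tau>" "Cmp \<tau>" by (rule t)
  show ?case
    by (intro mtrans_eqI[of _ _ "Obj A"])
      (simp_all add: mfunc_comp_assoc[OF \<rho>.F.monoidal_functor_axioms \<sigma>.F.monoidal_functor_axioms \<tau>.F.monoidal_functor_axioms]
        mfunc_comp_assoc[OF \<rho>.G.monoidal_functor_axioms \<sigma>.G.monoidal_functor_axioms \<tau>.G.monoidal_functor_axioms])
next
  case (6 A B f)
  then show ?case by (simp add: mfunc_comp_id)
next
  case (7 A B f)
  then show ?case by (simp add: mfunc_comp_id)
next
  case (8 A B \<sigma>)
  then have t: "monoidal_transformation A B (Src \<sigma>) (Tgt \<sigma>) (Cmp \<sigma>)" by auto
  interpret \<sigma>: monoidal_transformation A B "Src \<sigma>" "Tgt \<sigma>" "Cmp \<sigma>" by (rule t)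
  show ?case
    using 8 \<sigma>.F.monoidal_functor_axioms \<sigma>.G.monoidal_functor_axioms
    by (intro mtrans_eqI[of _ _ "Obj A"]) (simp_all add: mfunc_comp_id)
next
  case (9 A B \<sigma>)
  then have t: "monoidal_transformation A B (Src \<sigma>) (Tgt \<sigma>) (Cmp \<sigma>)" by auto
  interpret \<sigma>: monoidal_transformation A B "Src \<sigma>" "Tgt \<sigma>" "Cmp \<sigma>" by (rule t)
  show ?case
    using 9 \<sigma>.F.monoidal_functor_axioms \<sigma>.G.monoidal_functor_axioms
    by (intro mtrans_eqI[of _ _ "Obj A"]) (simp_all add: mfunc_comp_id)
qed

section \<open>Equipping a weak 2-group with adjoint equivalences\<close>

lemma truncate_simps [simp]:
  "Obj (moncat.truncate M) = Obj M" "Mor (moncat.truncate M) = Mor M"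
  "Dom (moncat.truncate M) = Dom M" "Cod (moncat.truncate M) = Cod M"
  "Idn (moncat.truncate M) = Idn M" "Comp (moncat.truncate M) = Comp M"
  "Tensor (moncat.truncate M) = Tensor M" "Unit (moncat.truncate M) = Unit M"
  "Assoc (moncat.truncate M) = Assoc M" "LUnit (moncat.truncate M) = LUnit M"
  "RUnit (moncat.truncate M) = RUnit M"
  by (simp_all add: moncat.truncate_def)

lemma Hom_truncate [simp]: "Hom (moncat.truncate M) = Hom M"
  by (intro ext) (simp add: Hom_def)

lemma invertible_truncate [simp]:
  "inverse_pair (moncat.truncate M) = inverse_pair M" "invertible (moncat.truncate M) = invertible M"
  "inverse_of (moncat.truncate M) = inverse_of M"
proof -
  show 1: "inverse_pair (moncat.truncate M) = inverse_pair M"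
    by (intro ext) (simp add: inverse_pair_def)
  show "invertible (moncat.truncate M) = invertible M" "inverse_of (moncat.truncate M) = inverse_of M"
    by (intro ext, simp add: invertible_def inverse_of_def 1)+
qed

lemma prod_cat_truncate [simp]:
  "prod_cat (moncat.truncate M) D = prod_cat M D" "prod_cat D (moncat.truncate M) = prod_cat D M"
  by (simp_all add: prod_cat_def)

text \<open>As for the following predicates, unfolding leads to axioms about fields that
  \<open>moncat.truncate\<close> keeps.\<close>

lemma category_truncate [simp]: "category (moncat.truncate M) \<longleftrightarrow> category M"
  by (simp add: category_def)

lemma cat_functor_truncate [simp]:
  "cat_functor (moncat.truncate M) D F \<longleftrightarrow> cat_functor M D F"
  "cat_functor D (moncat.truncate M) G \<longleftrightarrow> cat_functor D M G"
  by (simp_all add: cat_functor_def cat_functor_axioms_def)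

lemma natural_transformation_truncate [simp]:
  "natural_transformation (moncat.truncate M) D F G \<theta> \<longleftrightarrow> natural_transformation M D F G \<theta>"
  "natural_transformation D (moncat.truncate M) F' G' \<theta>' \<longleftrightarrow> natural_transformation D M F' G' \<theta>'"
  by (simp_all add: natural_transformation_def natural_transformation_axioms_def)

lemma natural_isomorphism_truncate [simp]:
  "natural_isomorphism (moncat.truncate M) D F G \<theta> \<longleftrightarrow> natural_isomorphism M D F G \<theta>"
  "natural_isomorphism D (moncat.truncate M) F' G' \<theta>' \<longleftrightarrow> natural_isomorphism D M F' G' \<theta>'"
  by (simp_all add: natural_isomorphism_def natural_isomorphism_axioms_def)

lemma monoidal_category_truncate [simp]:
  "monoidal_category (moncat.truncate M) \<longleftrightarrow> monoidal_category M"
  by (simp add: monoidal_category_def monoidal_category_axioms_def)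

lemma adjoint_equivalence_truncate [simp]:
  "adjoint_equivalence (moncat.truncate M) = adjoint_equivalence M"
  by (intro ext) (simp add: adjoint_equivalence_def adjunction_def)

lemma monoidal_functor_truncate [simp]:
  "monoidal_functor (moncat.truncate C) (moncat.truncate D) F \<longleftrightarrow> monoidal_functor C D F"
  by (simp add: monoidal_functor_def monoidal_functor_axioms_def)

lemma monoidal_transformation_truncate [simp]:
  "monoidal_transformation (moncat.truncate C) (moncat.truncate D) F G \<theta>
    \<longleftrightarrow> monoidal_transformation C D F G \<theta>"
  by (simp add: monoidal_transformation_def monoidal_transformation_axioms_def)

text \<open>The type of a hom category mentions the objects and morphisms of \<open>C\<close> and
  \<open>D\<close> but not their further fields, so the two sides can be compared by equality. This
  is what lets \<open>imp\<close> be the identity on homs.\<close>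

lemma mon_hom_cat_truncate: "mon_hom_cat (moncat.truncate C) (moncat.truncate D) = mon_hom_cat C D"
  by (simp add: mon_hom_cat_def mfunc_extensional_def)

lemma mfunc_truncate:
  "mfunc_id (moncat.truncate C) = mfunc_id C"
  "mfunc_comp (moncat.truncate C) (moncat.truncate E) = mfunc_comp C E"
  "mtrans_hcomp (moncat.truncate C) (moncat.truncate E) = mtrans_hcomp C E"
  by (simp_all add: fun_eq_iff mfunc_id_def mfunc_comp_def mtrans_hcomp_def)

lemma exists_coherent_2group:
  fixes C :: "('o, 'm) moncat"
  assumes "weak_2group C"
  shows "\<exists>C' :: ('o, 'm) coh_moncat. coherent_2group C' \<and> moncat.truncate C' = C"
proof -
  interpret weak_2group C by fact
  obtain y i e where adj: "\<And>x. x \<in> Obj C \<Longrightarrow> adjoint_equivalence C x (y x) (i x) (e x)"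
    using exists_adjoint_equivalence by metis
  \<comment> \<open>Appending the chosen data leaves the fields of \<open>C\<close> untouched, so
    forgetting it gives back \<open>C\<close> as a record, not merely up to isomorphism.\<close>
  define C' :: "('o, 'm) coh_moncat" where "C' = moncat.extend C (coh_moncat.fields y i e)"
  have C': "moncat.truncate C' = C" "Dual C' = y" "AdjUnit C' = i" "AdjCounit C' = e"
    by (simp_all add: C'_def moncat.extend_def moncat.truncate_def coh_moncat.fields_def)
  have "coherent_2group C'"
  proof (intro coherent_2group.intro coherent_2group_axioms.intro)
    \<comment> \<open>Since \<open>moncat.truncate C' = C\<close>, the invariance lemmas carry facts
      about \<open>C\<close> over to \<open>C'\<close>.\<close>
    show "monoidal_category C'"
      using monoidal_category_axioms monoidal_category_truncate[of C'] by (simp add: C'(1))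
    show "invertible C' f" if "f \<in> Mor C'" for f
      using mor_invertible[of f] that truncate_simps(2)[of C'] invertible_truncate(2)[of C']
      by (simp add: C'(1))
    show "adjoint_equivalence C' x (Dual C' x) (AdjUnit C' x) (AdjCounit C' x)" if "x \<in> Obj C'" for x
      using adj[of x] that truncate_simps(1)[of C'] adjoint_equivalence_truncate[of C']
      by (simp add: C')
  qed
  then show ?thesis using C'(1) by blast
qed

theorem theorem15:
  "\<exists>imp :: (('o, 'm) moncat, ('o, 'm, 'o, 'm) mfunc, ('o, 'm, 'o, 'm) mtrans,
            ('o, 'm) coh_moncat, ('o, 'm, 'o, 'm) mfunc, ('o, 'm, 'o, 'm) mtrans) two_func.
    two_functor W2G C2G imp \<and>
    (\<forall>C \<in> Ob W2G. moncat.truncate (OnOb imp C) = C) \<and>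
    (\<forall>C \<in> Ob W2G. \<forall>D \<in> Ob W2G.
      (\<forall>F \<in> Obj (HomCat W2G C D). FOb (OnHom imp C D) F = F) \<and>
      (\<forall>\<theta> \<in> Mor (HomCat W2G C D). FMor (OnHom imp C D) \<theta> = \<theta>))"
proof -
  \<comment> \<open>The axiom of choice picks one coherent structure for each weak 2-group,
    independently of all others.\<close>
  obtain j :: "('o, 'm) moncat \<Rightarrow> ('o, 'm) coh_moncat" where
    j: "\<And>C. weak_2group C \<Longrightarrow> coherent_2group (j C)" "\<And>C. weak_2group C \<Longrightarrow> moncat.truncate (j C) = C"
    using exists_coherent_2group by metis
  \<comment> \<open>Each equation is an invariance lemma at \<open>j C\<close> and
    \<open>j D\<close>, with the truncations replaced by \<open>C\<close> and
    \<open>D\<close>.\<close>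
  have hom: "mon_hom_cat (j C) (j D) = mon_hom_cat C D"
    and id: "mfunc_id (j C) = mfunc_id C"
    and comp: "mfunc_comp (j C) (j D) = mfunc_comp C D"
    and hcomp: "mtrans_hcomp (j C) (j D) = mtrans_hcomp C D"
    if "weak_2group C" "weak_2group D" for C D
    using j(2) that mon_hom_cat_truncate mfunc_truncate by metis+
  let ?imp = "\<lparr>OnOb = j, OnHom = (\<lambda>_ _. \<lparr>FOb = (\<lambda>F. F), FMor = (\<lambda>\<theta>. \<theta>)\<rparr>)\<rparr>"
  have W2G: "two_category (W2G :: (('o, 'm) moncat, _, _) two_cat)"
    unfolding W2G_def by (rule two_category_mon_two_cat) (simp add: weak_2group_def)
  have C2G: "two_category (C2G :: (('o, 'm) coh_moncat, _, _) two_cat)"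
    unfolding C2G_def by (rule two_category_mon_two_cat) (simp add: coherent_2group_def)
  have "two_functor W2G C2G ?imp"
  proof (intro two_functor.intro two_functor_axioms.intro W2G C2G)
    show "cat_functor (HomCat W2G A B) (HomCat C2G (OnOb ?imp A) (OnOb ?imp B)) (OnHom ?imp A B)"
      if "A \<in> Ob W2G" "B \<in> Ob W2G" for A B
      \<comment> \<open>The hom categories stay folded, so that after rewriting with
        \<open>hom\<close> this concerns the identity functor on a single category.\<close>
      using that by (intro cat_functorI) (simp_all add: W2G_def C2G_def hom mon_hom_category del: mon_hom_cat_simps)
  qed (auto simp: W2G_def C2G_def j id comp hcomp)
  then show ?thesis
    by (intro exI[of _ ?imp]) (simp add: W2G_def j)
qed

end
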